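(* Let $\mathcal L$ be a finite relational language of maximum arity $r\ge2$. Suppose $0<\epsilon<1$ and $k\ge r$ is an integer. Then there exist positive constants $c=c(k,r,\mathcal L,\epsilon)$ and $m=m(k,r)>1$ such that for all sufficiently large $n$ the following holds. Assume $\mathcal F$ is a collection of finite $\mathcal L$-structures, each of size at most $k$, and $\mathcal B:=\mathrm{Forb}(\mathcal F)\neq\emptyset$. For any $n$-element set $W$, there is a collection $\mathcal C$ of $\mathcal L_{\mathcal B}$-templates with domain $W$ such that 1. for all $\mathcal F$-free $\mathcal L$-structures $M$ with domain $W$, there is $C\in\mathcal C$ such that $M\unlhd_pC$; 2. for all $C\in\mathcal C$, $\mathrm{prob}(\tilde{\mathcal F},C)\le\epsilon$ and $\mathrm{prob}(\mathcal E,C)\le\epsilon$; 3. $\log|\mathcal C|\le cn^{r-\frac1m}\log n$.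
   Context: $\mathcal L$ is a finite relational first-order language with maximum arity $r\ge 2$. All formulas and types are quantifier-free. $\binom{V}{r}$ is the set of $r$-element subsets of $V$; $V^{\underline r}$ is the set of $r$-tuples of pairwise distinct elements of $V$; for $\bar a=(a_1,\dots,a_r)$, $\cup\bar a=\{a_1,\dots,a_r\}$ and, for a permutation $\mu$ of $[r]=\{1,\dots,r\}$, $\mu(\bar a)=(a_{\mu(1)},\dots,a_{\mu(r)})$. An enumeration of an $r$-element set $A$ is an $r$-tuple $\bar a$ with $\cup\bar a=A$. The size of a structure is the cardinality of its domain. An $\mathcal L$-structure is $\mathcal F$-free if no substructure of it is isomorphic to an element of $\mathcal F$; $\mathrm{Forb}(\mathcal F)$ is the class of all finite $\mathcal F$-free $\mathcal L$-structures. Types: $S_r(\mathcal B)$ is the set of complete quantifier-free $r$-types $p(x_1,\dots,x_r)$ in $\mathcal L$ that are proper (contain $x_i\ne x_j$ for $i\neq j$) and are realized in some element of $\mathcal B$. For a set $V$ let $C_V=\{c_v:v\in V\}$ be new constants; for $\bar a\in V^{\underline r}$, $p(c_{\bar a})$ is the set of sentences obtained by substituting $c_{a_i}$ for $x_i$; $S_r(C_V,\mathcal B)=\{p(c_{\bar a}):p\in S_r(\mathcal B),\bar a\in V^{\underline r}\}$. For an $\mathcal L$-structure $N$ and $A\subseteq \mathrm{dom}(N)$, $Diag^N(A)$ is the set of quantifier-free sentences in $\mathcal L\cup C_A$ true in $N$ when $c_a$ names $a$. $\mathcal L_{\mathcal B}=\{R_p:p\in S_r(\mathcal B)\}$ is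 the language with one $r$-ary relation symbol per element of $S_r(\mathcal B)$. An $\mathcal L_{\mathcal B}$-structure $M$ with domain $V$ is complete if for every $A\in\binom Vr$ there are an enumeration $\bar a$ of $A$ and $R_p\in\mathcal L_{\mathcal B}$ with $M\models R_p(\bar a)$. $M$ is an $\mathcal L_{\mathcal B}$-template if it is complete and (1) $M\models\neg R_p(\bar a)$ for all $p\in S_r(\mathcal B)$, $\bar a\in V^r\setminus V^{\underline r}$; (2) whenever $p,p'\in S_r(\mathcal B)$ and a permutation $\mu$ of $[r]$ satisfy $p(\bar x)=p'(\mu(\bar x))$, then for all $\bar a\in V^{\underline r}$, $M\models R_p(\bar a)$ iff $M\models R_{p'}(\mu(\bar a))$. For $A\in\binom Vr$, $Ch_M(A)=\{p(c_{\bar a})\in S_r(C_V,\mathcal B):\cup\bar a=A,\ M\models R_p(\bar a)\}$. A choice function for $M$ is $\chi:\binom Vr\to S_r(C_V,\mathcal B)$ with $\chi(A)\in Ch_M(A)$ for all $A$. For complete $M$ with domain $V$, an $\mathcal L$-structure $N$ with domain $V$ satisfies $N\unlhd_p M$ (is a full subpattern of $M$) if there is a choice function $\chi$ for $M$ with $Diag^N(A)=\chi(A)$ for all $A\in\binom Vr$. $\tilde{\mathcal F}$ is the class of (complete) $\mathcal L_{\mathcal B}$-structures $B$ such that $F\unlhd_pB$ for some $F\in\mathcal F$. For $r<\ell<2r$, an error of size $\ell$ is a complete $\mathcal L_{\mathcal B}$-structure $B$ of size $\ell$ for which there are $\bar a_1,\bar a_2\in \mathrm{dom}(B)^{\underline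 r}$ with $\mathrm{dom}(B)=(\cup\bar a_1)\cup(\cup\bar a_2)$ and $p_1,p_2\in S_r(\mathcal B)$ with $B\models R_{p_1}(\bar a_1)\wedge R_{p_2}(\bar a_2)$ but $p_1(c_{\bar a_1})\cup p_2(c_{\bar a_2})$ unsatisfiable. $\mathcal E$ is the class of all errors of size $\ell$ for some $r<\ell<2r$. For finite structures $B$ of size $\ell$ and $M$ of size $L$ in the same language, $\mathrm{prob}(B,M)$ is the number of substructures of $M$ isomorphic to $B$ divided by $\binom L\ell$. For a class $\mathcal D$ of finite structures, $\mathrm{prob}(\mathcal D,M)=\max\{\mathrm{prob}(B,M):B\in\mathcal D\}$ (maximum over one representative of each isomorphism type; by convention $\max\emptyset=0$).
   Formalization: The class F̃ is restricted to structures B of size at least r; as written, an F in 𝓕 of size below r is vacuously a full subpattern of a B with empty relations, which has density 1 in every template, so (2) fails, e.g. for 𝓕 = {one looped vertex}, r = k = 2. *)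

theory Defs
  imports
    Complex_Main
    "HOL-Library.Ramsey"
    "HOL-Combinatorics.Permutations"
begin

section \<open>Relational languages and structures\<close>

record 's language =
  symbols :: "'s set"
  arity :: "'s \<Rightarrow> nat"

definition finite_language :: "'s language \<Rightarrow> bool" where
  "finite_language L \<longleftrightarrow> finite (symbols L) \<and> symbols L \<noteq> {}"

definition max_arity :: "'s language \<Rightarrow> nat" where
  "max_arity L = Max (arity L ` symbols L)"

text \<open>Tuples are lists, with positions counted from 0.\<close>

definition tuples :: "'v set \<Rightarrow> nat \<Rightarrow> 'v list set" where
  "tuples V n = {as. length as = n \<and> set as \<subseteq> V}"

definition dtuples :: "'v set \<Rightarrow> nat \<Rightarrow> 'v list set" where
  "dtuples V n = {as \<in> tuples V n. distinct as}"

record ('s, 'v) struc =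
  domain :: "'v set"
  interp :: "'s \<Rightarrow> 'v list set"

text \<open>Structures are nonempty. Symbols outside the language get the empty interpretation, so
  that two \<open>L\<close>-structures are equal as records iff they are equal as \<open>L\<close>-structures
  (this matters wherever structures are counted).\<close>

definition is_struc :: "'s language \<Rightarrow> ('s, 'v) struc \<Rightarrow> bool" where
  "is_struc L M \<longleftrightarrow> domain M \<noteq> {} \<and>
     (\<forall>R\<in>symbols L. interp M R \<subseteq> tuples (domain M) (arity L R)) \<and>
     (\<forall>R. R \<notin> symbols L \<longrightarrow> interp M R = {})"

definition isomorphic :: "'s language \<Rightarrow> ('s, 'v) struc \<Rightarrow> ('s, 'w) struc \<Rightarrow> bool" where
  "isomorphic L M N \<longleftrightarrow> (\<exists>f. bij_betw f (domain M) (domain N) \<and>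
     (\<forall>R\<in>symbols L. \<forall>as\<in>tuples (domain M) (arity L R).
        as \<in> interp M R \<longleftrightarrow> map f as \<in> interp N R))"

definition induced :: "('s, 'v) struc \<Rightarrow> 'v set \<Rightarrow> ('s, 'v) struc" where
  "induced M X = \<lparr>domain = X, interp = (\<lambda>R. {as \<in> interp M R. set as \<subseteq> X})\<rparr>"

definition substrucs :: "('s, 'v) struc \<Rightarrow> ('s, 'v) struc set" where
  "substrucs M = {induced M X | X. X \<subseteq> domain M \<and> X \<noteq> {}}"

definition is_free :: "'s language \<Rightarrow> ('s, 'w) struc set \<Rightarrow> ('s, 'v) struc \<Rightarrow> bool" where
  "is_free L \<F> M \<longleftrightarrow> \<not> (\<exists>N\<in>substrucs M. \<exists>F\<in>\<F>. isomorphic L N F)"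

definition Forb :: "'s language \<Rightarrow> ('s, 'v) struc set \<Rightarrow> ('s, 'v) struc set" where
  "Forb L \<F> = {M. is_struc L M \<and> finite (domain M) \<and> is_free L \<F> M}"


section \<open>Quantifier-free formulas and types\<close>

text \<open>The parameter \<open>'t\<close> is the type of terms, which in a relational language are just variables
  or constants: formulas in \<open>x\<^sub>1,\<dots>,x\<^sub>r\<close> have \<open>'t = nat\<close> with the variables \<open>0,\<dots>,r-1\<close>,
  while sentences over constants \<open>c\<^sub>v\<close>, \<open>v \<in> V\<close>, have the elements of \<open>V\<close> as terms.\<close>

datatype ('s, 't) fm =
    Eq 't 't
  | Rel 's "'t list"
  | Neg "('s, 't) fm"
  | Conj "('s, 't) fm" "('s, 't) fm"

fun wf_fm :: "'s language \<Rightarrow> 't set \<Rightarrow> ('s, 't) fm \<Rightarrow> bool" where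
  "wf_fm L T (Eq s t) \<longleftrightarrow> s \<in> T \<and> t \<in> T"
| "wf_fm L T (Rel R ts) \<longleftrightarrow> R \<in> symbols L \<and> ts \<in> tuples T (arity L R)"
| "wf_fm L T (Neg \<phi>) \<longleftrightarrow> wf_fm L T \<phi>"
| "wf_fm L T (Conj \<phi> \<psi>) \<longleftrightarrow> wf_fm L T \<phi> \<and> wf_fm L T \<psi>"

definition qf_fms :: "'s language \<Rightarrow> 't set \<Rightarrow> ('s, 't) fm set" where
  "qf_fms L T = {\<phi>. wf_fm L T \<phi>}"

fun sat :: "('s, 'v) struc \<Rightarrow> ('t \<Rightarrow> 'v) \<Rightarrow> ('s, 't) fm \<Rightarrow> bool" where
  "sat M e (Eq s t) \<longleftrightarrow> e s = e t"
| "sat M e (Rel R ts) \<longleftrightarrow> map e ts \<in> interp M R"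
| "sat M e (Neg \<phi>) \<longleftrightarrow> \<not> sat M e \<phi>"
| "sat M e (Conj \<phi> \<psi>) \<longleftrightarrow> sat M e \<phi> \<and> sat M e \<psi>"

text \<open>All sets of formulas considered below involve finitely many terms, so it is no restriction
  to look for models with domain contained in \<^typ>\<open>nat\<close>.\<close>

definition satisfiable :: "'s language \<Rightarrow> ('s, 't) fm set \<Rightarrow> bool" where
  "satisfiable L \<Gamma> \<longleftrightarrow> (\<exists>(M :: ('s, nat) struc) e.
     is_struc L M \<and> range e \<subseteq> domain M \<and> (\<forall>\<phi>\<in>\<Gamma>. sat M e \<phi>))"

definition complete_qf_type :: "'s language \<Rightarrow> nat \<Rightarrow> ('s, nat) fm set \<Rightarrow> bool" where
  "complete_qf_type L r p \<longleftrightarrow> p \<subseteq> qf_fms L {..<r} \<and> satisfiable L p \<and>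
     (\<forall>\<phi>\<in>qf_fms L {..<r}. \<phi> \<in> p \<or> Neg \<phi> \<in> p)"

definition proper_type :: "nat \<Rightarrow> ('s, nat) fm set \<Rightarrow> bool" where
  "proper_type r p \<longleftrightarrow> (\<forall>i<r. \<forall>j<r. i \<noteq> j \<longrightarrow> Neg (Eq i j) \<in> p)"

definition realized_in :: "nat \<Rightarrow> ('s, nat) fm set \<Rightarrow> ('s, 'v) struc \<Rightarrow> bool" where
  "realized_in r p N \<longleftrightarrow> (\<exists>as\<in>tuples (domain N) r. \<forall>\<phi>\<in>p. sat N ((!) as) \<phi>)"

definition S_types :: "'s language \<Rightarrow> nat \<Rightarrow> ('s, 'v) struc set \<Rightarrow> ('s, nat) fm set set" where
  "S_types L r \<B> = {p. complete_qf_type L r p \<and> proper_type r p \<and> (\<exists>N\<in>\<B>. realized_in r p N)}"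

text \<open>\<open>inst p as\<close> is \<open>p(c\<^sub>a)\<close>: the \<open>i\<close>-th variable is replaced by the \<open>i\<close>-th entry of \<open>as\<close>.
  With \<open>as\<close> a tuple of variables it is a change of variables.\<close>

definition inst :: "('s, nat) fm set \<Rightarrow> 't list \<Rightarrow> ('s, 't) fm set" where
  "inst p as = map_fm id ((!) as) ` p"

definition S_const :: "'s language \<Rightarrow> nat \<Rightarrow> 'v set \<Rightarrow> ('s, 'w) struc set \<Rightarrow> ('s, 'v) fm set set" where
  "S_const L r V \<B> = {inst p as | p as. p \<in> S_types L r \<B> \<and> as \<in> dtuples V r}"

definition Diag :: "'s language \<Rightarrow> ('s, 'v) struc \<Rightarrow> 'v set \<Rightarrow> ('s, 'v) fm set" where
  "Diag L N A = {\<phi> \<in> qf_fms L A. sat N (\<lambda>a. a) \<phi>}"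


section \<open>Templates and full subpatterns\<close>

text \<open>The symbol \<open>R\<^sub>p\<close> is represented by the type \<open>p\<close> itself.\<close>

definition type_language ::
    "'s language \<Rightarrow> nat \<Rightarrow> ('s, 'w) struc set \<Rightarrow> ('s, nat) fm set language" where
  "type_language L r \<B> = \<lparr>symbols = S_types L r \<B>, arity = (\<lambda>_. r)\<rparr>"

definition complete_struc ::
    "'s language \<Rightarrow> nat \<Rightarrow> ('s, 'w) struc set \<Rightarrow> (('s, nat) fm set, 'v) struc \<Rightarrow> bool" where
  "complete_struc L r \<B> M \<longleftrightarrow> is_struc (type_language L r \<B>) M \<and>
     (\<forall>A\<in>nsets (domain M) r. \<exists>as\<in>dtuples (domain M) r. \<exists>p\<in>S_types L r \<B>.
        set as = A \<and> as \<in> interp M p)"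

definition permute_tuple :: "(nat \<Rightarrow> nat) \<Rightarrow> 'v list \<Rightarrow> 'v list" where
  "permute_tuple \<mu> as = map (\<lambda>i. as ! \<mu> i) [0..<length as]"

definition template ::
    "'s language \<Rightarrow> nat \<Rightarrow> ('s, 'w) struc set \<Rightarrow> (('s, nat) fm set, 'v) struc \<Rightarrow> bool" where
  "template L r \<B> M \<longleftrightarrow> complete_struc L r \<B> M \<and>
     (\<forall>p\<in>S_types L r \<B>. \<forall>as\<in>tuples (domain M) r - dtuples (domain M) r. as \<notin> interp M p) \<and>
     (\<forall>p\<in>S_types L r \<B>. \<forall>p'\<in>S_types L r \<B>. \<forall>\<mu>.
        \<mu> permutes {..<r} \<and> p = inst p' (permute_tuple \<mu> [0..<r]) \<longrightarrow>
        (\<forall>as\<in>dtuples (domain M) r. as \<in> interp M p \<longleftrightarrow> permute_tuple \<mu> as \<in> interp M p'))"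

definition Ch ::
    "'s language \<Rightarrow> nat \<Rightarrow> ('s, 'w) struc set \<Rightarrow> (('s, nat) fm set, 'v) struc \<Rightarrow> 'v set
      \<Rightarrow> ('s, 'v) fm set set" where
  "Ch L r \<B> M A = {inst p as | p as.
     p \<in> S_types L r \<B> \<and> as \<in> dtuples (domain M) r \<and> set as = A \<and> as \<in> interp M p}"

definition choice_fun ::
    "'s language \<Rightarrow> nat \<Rightarrow> ('s, 'w) struc set \<Rightarrow> (('s, nat) fm set, 'v) struc
      \<Rightarrow> ('v set \<Rightarrow> ('s, 'v) fm set) \<Rightarrow> bool" where
  "choice_fun L r \<B> M \<chi> \<longleftrightarrow> (\<forall>A\<in>nsets (domain M) r. \<chi> A \<in> S_const L r (domain M) \<B> \<and> \<chi> A \<in> Ch L r \<B> M A)"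

definition full_subpattern ::
    "'s language \<Rightarrow> nat \<Rightarrow> ('s, 'w) struc set \<Rightarrow> ('s, 'v) struc
      \<Rightarrow> (('s, nat) fm set, 'v) struc \<Rightarrow> bool" where
  "full_subpattern L r \<B> N M \<longleftrightarrow>
     complete_struc L r \<B> M \<and> is_struc L N \<and> domain N = domain M \<and>
     (\<exists>\<chi>. choice_fun L r \<B> M \<chi> \<and> (\<forall>A\<in>nsets (domain M) r. Diag L N A = \<chi> A))"


section \<open>Forbidden patterns, errors and densities\<close>

text \<open>Over a domain with fewer than \<open>r\<close> elements there are no \<open>r\<close>-subsets, so every structure
  is vacuously a full subpattern of every complete structure on the same domain. Such degenerate
  patterns are left out: a one-element structure in \<open>\<F>\<close>, say, would otherwise put the one-element
  structure with all relations empty among the forbidden patterns, and that one has density 1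
  in every template.\<close>

definition forb_patterns ::
    "'s language \<Rightarrow> nat \<Rightarrow> ('s, 'v) struc set \<Rightarrow> (('s, nat) fm set, 'v) struc set" where
  "forb_patterns L r \<F> = {B. r \<le> card (domain B) \<and> complete_struc L r (Forb L \<F>) B \<and>
     (\<exists>F\<in>\<F>. full_subpattern L r (Forb L \<F>) F B)}"

definition is_error ::
    "'s language \<Rightarrow> nat \<Rightarrow> ('s, 'w) struc set \<Rightarrow> nat \<Rightarrow> (('s, nat) fm set, 'v) struc \<Rightarrow> bool" where
  "is_error L r \<B> l B \<longleftrightarrow> complete_struc L r \<B> B \<and> finite (domain B) \<and> card (domain B) = l \<and>
     (\<exists>as1\<in>dtuples (domain B) r. \<exists>as2\<in>dtuples (domain B) r.
        domain B = set as1 \<union> set as2 \<and>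
        (\<exists>p1\<in>S_types L r \<B>. \<exists>p2\<in>S_types L r \<B>.
           as1 \<in> interp B p1 \<and> as2 \<in> interp B p2 \<and> \<not> satisfiable L (inst p1 as1 \<union> inst p2 as2)))"

definition errors ::
    "'s language \<Rightarrow> nat \<Rightarrow> ('s, 'v) struc set \<Rightarrow> (('s, nat) fm set, 'v) struc set" where
  "errors L r \<B> = {B. \<exists>l. r < l \<and> l < 2 * r \<and> is_error L r \<B> l B}"

definition prob :: "'s language \<Rightarrow> ('s, 'w) struc \<Rightarrow> ('s, 'v) struc \<Rightarrow> real" where
  "prob L B M = real (card {N \<in> substrucs M. isomorphic L N B}) /
     real (card (domain M) choose card (domain B))"

text \<open>The maximum over a class, 0 for the empty class. Isomorphic structures have equal density,
  so no choice of representatives is needed; the set of values is finite as soon as the structures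
  in the class have bounded size.\<close>

definition prob_class :: "'s language \<Rightarrow> ('s, 'w) struc set \<Rightarrow> ('s, 'v) struc \<Rightarrow> real" where
  "prob_class L \<D> M = Max (insert 0 ((\<lambda>B. prob L B M) ` \<D>))"

end

theory Submission
  imports Defs
begin

text \<open>A structure \<open>M\<close> on \<open>W\<close> is determined by its diagrams on the \<open>r\<close>-subsets of \<open>W\<close>, because no relation
sees more than \<open>r\<close> points at once. Regard the sets of sentences \<open>p(c\<^sub>a)\<close> as vertices; there are at most
\<open>N = t n\<^sup>r\<close> of them, \<open>t - 1\<close> being the number of complete types. Then \<open>M\<close> becomes a set of vertices with exactly
one vertex over each \<open>r\<close>-subset, a template becomes a set \<open>U\<close> of vertices with at least one vertex over
each \<open>r\<close>-subset, and \<open>M\<close> is a full subpattern of a template exactly when its vertex set is contained in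
\<open>U\<close>. So the theorem asks for few sets \<open>U\<close>, sparse in bad patterns, that together contain all \<open>\<F>\<close>-free
structures: it is a hypergraph container theorem.

Fix a forbidden pattern \<open>B\<close> on \<open>\<ell>\<close> points and a set \<open>U\<close>. Each copy of \<open>B\<close> in the template of \<open>U\<close> sits on an
\<open>\<ell>\<close>-set \<open>X \<subseteq> W\<close> and yields a set of \<open>\<ell> choose r\<close> vertices in \<open>U\<close>, namely the diagrams of a structure from
\<open>\<F>\<close> placed on \<open>X\<close>; an \<open>\<F>\<close>-free structure cannot contain all of them. An error yields two jointly
unsatisfiable vertices, which no structure contains both. If \<open>B\<close> has density above \<open>\<epsilon>\<close>, these edges form
a hypergraph on \<open>U\<close> with a constant proportion of \<open>n\<^bsup>\<ell>\<^esup>\<close> edges. Its degrees are at most \<open>D = n\<^bsup>\<ell>-r\<^esup>\<close>, and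
its codegrees are at most \<open>D / n\<close>, because two vertices of one edge lie over different \<open>r\<close>-sets and
so fix at least \<open>r + 1\<close> points of \<open>X\<close> (\<open>hypergraph_of_supported_edges\<close>).

The container lemma (\<open>hypergraph_container_lemma\<close>) covers the edge-free subsets of such a hypergraph by
few sets, each smaller than \<open>U\<close> by a constant multiple of \<open>N\<close>. It is proved by induction on the
uniformity with the algorithm of Kleitman and Winston, which replaces the hypergraph by the links of a few
vertices of the edge-free set. Going down one uniformity costs a factor \<open>\<tau>\<close> in the degrees while the
codegrees do not grow, so the lemma works as long as the codegrees of an \<open>(s + 1)\<close>-uniform hypergraph are
at most \<open>\<tau>\<^sup>s D\<close>. Here this means \<open>1/n \<le> \<tau>\<^sup>s\<close>, and \<open>\<tau> = n\<^bsup>-1/q\<^esup>\<close> with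
\<open>q = (k choose r) + 2\<close> serves all uniformities that occur. The number of containers is \<open>(N + 1)\<^bsup>O(\<tau> N)\<^esup>\<close>, and
\<open>\<tau> N\<close> is of order \<open>n\<^bsup>r - 1/q\<^esup>\<close>; hence \<open>m = q\<close>.

Starting from the set of all vertices, split every container that has a pattern of density above \<open>\<epsilon>\<close>
(\<open>bad_container_step\<close>). Each split removes a constant proportion of \<open>N\<close> vertices, so boundedly many rounds
suffice (\<open>coverable_iterate\<close>), and the logarithm of the number of containers grows by a constant factor only.\<close>

section \<open>Covering families of sets\<close>

definition coverable :: "'v set set \<Rightarrow> nat \<Rightarrow> ('v set \<Rightarrow> bool) \<Rightarrow> bool" where
  "coverable \<I> m P \<longleftrightarrow> (\<exists>\<C>. finite \<C> \<and> card \<C> \<le> m \<and> (\<forall>C\<in>\<C>. P C) \<and> (\<forall>I\<in>\<I>. \<exists>C\<in>\<C>. I \<subseteq> C))"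

lemma coverable_mono:
  assumes "coverable \<I> m P" "\<I>' \<subseteq> \<I>" "m \<le> m'" "\<And>C. P C \<Longrightarrow> Q C"
  shows "coverable \<I>' m' Q"
proof -
  obtain \<C> where C: "finite \<C>" "card \<C> \<le> m" "\<forall>C\<in>\<C>. P C" "\<forall>I\<in>\<I>. \<exists>C\<in>\<C>. I \<subseteq> C"
    using assms(1) unfolding coverable_def by metis
  show ?thesis unfolding coverable_def
    using C assms(2-4) by (intro exI[of _ \<C>] conjI) auto
qed

lemma coverable_singleton:
  assumes "P C" "\<And>I. I \<in> \<I> \<Longrightarrow> I \<subseteq> C" "1 \<le> m"
  shows "coverable \<I> m P"
proof -
  have "finite {C} \<and> card {C} \<le> m \<and> (\<forall>X\<in>{C}. P X) \<and> (\<forall>I\<in>\<I>. \<exists>X\<in>{C}. I \<subseteq> X)"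
    using assms by simp
  then show ?thesis unfolding coverable_def by (rule exI)
qed

lemma coverable_Un:
  assumes "coverable \<I> m P" "coverable \<I>' m' P"
  shows "coverable (\<I> \<union> \<I>') (m + m') P"
proof -
  obtain \<C> where C: "finite \<C>" "card \<C> \<le> m" "\<forall>C\<in>\<C>. P C" "\<forall>I\<in>\<I>. \<exists>C\<in>\<C>. I \<subseteq> C"
    using assms(1) unfolding coverable_def by metis
  obtain \<D> where D: "finite \<D>" "card \<D> \<le> m'" "\<forall>C\<in>\<D>. P C" "\<forall>I\<in>\<I>'. \<exists>C\<in>\<D>. I \<subseteq> C"
    using assms(2) unfolding coverable_def by metis
  have "card (\<C> \<union> \<D>) \<le> m + m'" using card_Un_le[of \<C> \<D>] C(2) D(2) by linarith
  moreover have "\<forall>I\<in>\<I> \<union> \<I>'. \<exists>C\<in>\<C> \<union> \<D>. I \<subseteq> C"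
  proof
    fix I assume "I \<in> \<I> \<union> \<I>'"
    then show "\<exists>C\<in>\<C> \<union> \<D>. I \<subseteq> C" unfolding bex_Un using C(4) D(4) by (elim UnE) simp_all
  qed
  moreover have "\<forall>C\<in>\<C> \<union> \<D>. P C" unfolding ball_Un using C(3) D(3) by simp
  ultimately have "finite (\<C> \<union> \<D>) \<and> card (\<C> \<union> \<D>) \<le> m + m' \<and> (\<forall>C\<in>\<C> \<union> \<D>. P C) \<and>
      (\<forall>I\<in>\<I> \<union> \<I>'. \<exists>C\<in>\<C> \<union> \<D>. I \<subseteq> C)" using C(1) D(1) by simp
  then show ?thesis unfolding coverable_def by (rule exI)
qed

lemma coverable_refine:
  assumes "coverable \<I> m P" "\<And>C. P C \<Longrightarrow> coverable {I\<in>\<I>. I \<subseteq> C} m' Q"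
  shows "coverable \<I> (m * m') Q"
proof -
  obtain \<C> where C: "finite \<C>" "card \<C> \<le> m" "\<forall>C\<in>\<C>. P C" "\<forall>I\<in>\<I>. \<exists>C\<in>\<C>. I \<subseteq> C"
    using assms(1) unfolding coverable_def by metis
  have "\<forall>C\<in>\<C>. \<exists>\<D>. finite \<D> \<and> card \<D> \<le> m' \<and> (\<forall>D\<in>\<D>. Q D) \<and> (\<forall>I\<in>{I\<in>\<I>. I \<subseteq> C}. \<exists>D\<in>\<D>. I \<subseteq> D)"
    using assms(2) C(3) unfolding coverable_def by blast
  then obtain \<D> where D: "\<And>C. C \<in> \<C> \<Longrightarrow> finite (\<D> C) \<and> card (\<D> C) \<le> m' \<and> (\<forall>D\<in>\<D> C. Q D) \<and>
      (\<forall>I\<in>{I\<in>\<I>. I \<subseteq> C}. \<exists>D\<in>\<D> C. I \<subseteq> D)" by metis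
  have "card (\<Union>C\<in>\<C>. \<D> C) \<le> (\<Sum>C\<in>\<C>. card (\<D> C))" using C(1) by (rule card_UN_le)
  also have "\<dots> \<le> card \<C> * m'" using D sum_bounded_above[of \<C> "\<lambda>C. card (\<D> C)" m'] by simp
  also have "\<dots> \<le> m * m'" using C(2) by simp
  finally have "card (\<Union>C\<in>\<C>. \<D> C) \<le> m * m'" .
  moreover have "\<forall>I\<in>\<I>. \<exists>D\<in>(\<Union>C\<in>\<C>. \<D> C). I \<subseteq> D"
  proof
    fix I assume I: "I \<in> \<I>"
    obtain C where C': "C \<in> \<C>" "I \<subseteq> C" using bspec[OF C(4) I] by (elim bexE)
    then have "\<exists>D\<in>\<D> C. I \<subseteq> D" using D[OF C'(1)] I by simp
    then obtain D' where D': "D' \<in> \<D> C" "I \<subseteq> D'" by (elim bexE)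
    then show "\<exists>D\<in>(\<Union>C\<in>\<C>. \<D> C). I \<subseteq> D" by (intro bexI[of _ D'] UN_I[OF C'(1)])
  qed
  moreover have "\<forall>D\<in>(\<Union>C\<in>\<C>. \<D> C). Q D" using D by simp
  moreover have "finite (\<Union>C\<in>\<C>. \<D> C)" using C(1) D by simp
  ultimately have "finite (\<Union>C\<in>\<C>. \<D> C) \<and> card (\<Union>C\<in>\<C>. \<D> C) \<le> m * m' \<and>
      (\<forall>D\<in>(\<Union>C\<in>\<C>. \<D> C). Q D) \<and> (\<forall>I\<in>\<I>. \<exists>D\<in>(\<Union>C\<in>\<C>. \<D> C). I \<subseteq> D)" by (intro conjI)
  then show ?thesis unfolding coverable_def by (rule exI)
qed

section \<open>Containers in hypergraphs with small codegrees\<close>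

text \<open>Edges are indexed: \<open>E\<close> is a set of labels and \<open>f x\<close> is the vertex set of the edge \<open>x\<close>. Different labels
may carry the same vertex set, as happens when links of several vertices are collected.\<close>

definition deg :: "'e set \<Rightarrow> ('e \<Rightarrow> 'v set) \<Rightarrow> 'v \<Rightarrow> nat" where
  "deg E f v = card {x\<in>E. v \<in> f x}"

definition edge_free :: "'e set \<Rightarrow> ('e \<Rightarrow> 'v set) \<Rightarrow> 'v set \<Rightarrow> bool" where
  "edge_free E f I \<longleftrightarrow> (\<forall>x\<in>E. \<not> f x \<subseteq> I)"

lemma sum_deg:
  assumes "finite V" "finite E" "\<And>x. x \<in> E \<Longrightarrow> f x \<subseteq> V \<and> card (f x) = s"
  shows "(\<Sum>v\<in>V. deg E f v) = s * card E"
proof -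
  have "(\<Sum>v\<in>V. deg E f v) = (\<Sum>v\<in>V. \<Sum>x\<in>E. if v \<in> f x then 1 else 0)"
  proof (intro sum.cong refl)
    fix v
    have "{x\<in>E. v \<in> f x} = E \<inter> {x. v \<in> f x}" by auto
    then show "deg E f v = (\<Sum>x\<in>E. if v \<in> f x then 1 else 0)"
      unfolding deg_def using assms(2) by (simp add: sum.If_cases)
  qed
  also have "\<dots> = (\<Sum>x\<in>E. \<Sum>v\<in>V. if v \<in> f x then 1 else 0)" by (rule sum.swap)
  also have "\<dots> = (\<Sum>x\<in>E. card (f x))"
  proof (intro sum.cong refl)
    fix x assume "x \<in> E"
    then have "V \<inter> f x = f x" using assms(3) by blast
    then show "(\<Sum>v\<in>V. if v \<in> f x then 1 else 0) = card (f x)" using assms(1)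
      by (simp add: sum.If_cases)
  qed
  also have "\<dots> = s * card E" using assms(3) by simp
  finally show ?thesis .
qed

lemma card_edges_meeting_le:
  assumes "finite E" "finite U" "\<And>v. v \<in> U \<Longrightarrow> real (deg E f v) \<le> D"
    "\<And>x. x \<in> E \<Longrightarrow> f x \<inter> U \<noteq> {}"
  shows "real (card E) \<le> D * real (card U)"
proof -
  have "E = (\<Union>v\<in>U. {x\<in>E. v \<in> f x})" using assms(4) by auto
  then have "card E \<le> (\<Sum>v\<in>U. deg E f v)"
    using card_UN_le[OF assms(2), of "\<lambda>v. {x\<in>E. v \<in> f x}"] by (simp add: deg_def)
  then have "real (card E) \<le> (\<Sum>v\<in>U. real (deg E f v))" by (simp flip: of_nat_sum)
  also have "\<dots> \<le> D * real (card U)" using sum_bounded_above[of U "\<lambda>v. real (deg E f v)" D] assms(3)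
    by (simp add: mult.commute)
  finally show ?thesis .
qed

lemma deg_mono: "finite E \<Longrightarrow> E' \<subseteq> E \<Longrightarrow> deg E' f v \<le> deg E f v"
  unfolding deg_def by (intro card_mono) auto

locale hypergraph =
  fixes V :: "'v set" and E :: "'e set" and f :: "'e \<Rightarrow> 'v set" and s :: nat and D D2 :: real
  assumes finite_V: "finite V" and finite_E: "finite E"
    and edge: "x \<in> E \<Longrightarrow> f x \<subseteq> V \<and> card (f x) = s"
    and deg_le: "real (deg E f v) \<le> D"
    and codeg_le: "u \<noteq> v \<Longrightarrow> real (card {x\<in>E. u \<in> f x \<and> v \<in> f x}) \<le> D2"
    and D2_nonneg: "0 \<le> D2"
begin

text \<open>A state of the Kleitman--Winston walk that explores an edge-free set \<open>I\<close>. The vertices outside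
\<open>A \<union> S\<close> are known not to lie in \<open>I\<close>, those of \<open>S\<close> are known to lie in \<open>I\<close>, and those of \<open>A\<close> are undecided.
The labels \<open>E'\<close> with the vertex sets \<open>g\<close> form a hypergraph of one lower uniformity, made of edges in
links of vertices of \<open>S\<close>; as \<open>S \<subseteq> I\<close>, the set \<open>I\<close> is edge-free for \<open>g\<close>, too. Each
chosen vertex has contributed at least \<open>\<beta> D\<close> edges, which makes the new hypergraph dense after many choices.\<close>

definition link_state :: "real \<Rightarrow> real \<Rightarrow> 'v set \<Rightarrow> 'v set \<Rightarrow> 'e set \<Rightarrow> ('e \<Rightarrow> 'v set) \<Rightarrow> bool" where
  "link_state \<beta> \<tau> A S E' g \<longleftrightarrow> A \<subseteq> V \<and> S \<subseteq> V \<and> A \<inter> S = {} \<and> E' \<subseteq> E \<and>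
     (\<forall>x\<in>E'. \<exists>v\<in>S. v \<in> f x \<and> g x = f x - {v}) \<and>
     (\<forall>u. real (deg E' g u) \<le> \<tau> * D + D2) \<and>
     real (card S) * \<beta> * D \<le> real (card E')"

text \<open>The edges that may still be moved to the link hypergraph. Edges through a saturated vertex, one whose degree
in the link hypergraph has reached \<open>\<tau> D\<close>, are withheld in order to bound the degrees there by \<open>\<tau> D + D2\<close>.\<close>

definition active :: "real \<Rightarrow> 'v set \<Rightarrow> 'e set \<Rightarrow> ('e \<Rightarrow> 'v set) \<Rightarrow> 'e set" where
  "active \<tau> A E' g = {x\<in>E. f x \<subseteq> A \<and> (\<forall>u\<in>f x. real (deg E' g u) < \<tau> * D)}"

lemma link_state_remove:
  "link_state \<beta> \<tau> A S E' g \<Longrightarrow> link_state \<beta> \<tau> (A - {v}) S E' g"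
  unfolding link_state_def by (elim conjE, intro conjI) (blast | assumption)+

text \<open>Choosing \<open>v\<close> moves all active edges through \<open>v\<close> to the link hypergraph. A vertex \<open>u\<close> gains at most the
codegree of \<open>u\<close> and \<open>v\<close>, and it gains nothing unless it was unsaturated; so its degree never
exceeds \<open>\<tau> D + D2\<close>.\<close>

lemma link_state_add:
  assumes st: "link_state \<beta> \<tau> A S E' g" and v: "v \<in> A"
    and large: "\<beta> * D \<le> real (deg (active \<tau> A E' g) f v)"
  defines "X \<equiv> {x\<in>active \<tau> A E' g. v \<in> f x}"
  shows "link_state \<beta> \<tau> (A - {v}) (insert v S) (E' \<union> X) (\<lambda>x. if x \<in> E' then g x else f x - {v})"
proof -
  let ?g = "\<lambda>x. if x \<in> E' then g x else f x - {v}"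
  have A: "A \<subseteq> V" "S \<subseteq> V" "A \<inter> S = {}" "E' \<subseteq> E" and wit: "\<forall>x\<in>E'. \<exists>v\<in>S. v \<in> f x \<and> g x = f x - {v}"
    and dg: "\<And>u. real (deg E' g u) \<le> \<tau> * D + D2" and cE: "real (card S) * \<beta> * D \<le> real (card E')"
    using st unfolding link_state_def by auto
  have finE': "finite E'" using A(4) finite_E finite_subset by blast
  have XE: "X \<subseteq> E" unfolding X_def active_def by auto
  have finX: "finite X" using XE finite_E finite_subset by blast
  \<comment> \<open>moved edges have a vertex in the old chosen set, active ones lie inside the disjoint set of undecided vertices\<close>
  have disj: "E' \<inter> X = {}" using wit A(3) unfolding X_def active_def by blast
  have wit': "\<forall>x\<in>E' \<union> X. \<exists>w\<in>insert v S. w \<in> f x \<and> ?g x = f x - {w}"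
    using wit disj unfolding X_def by auto
  have dg': "real (deg (E' \<union> X) ?g u) \<le> \<tau> * D + D2" for u
  proof (cases "u \<noteq> v \<and> (\<exists>x\<in>X. u \<in> f x)")
    case True
    then have "u \<noteq> v" and unsat: "real (deg E' g u) < \<tau> * D" unfolding X_def active_def by auto
    have "deg (E' \<union> X) ?g u \<le> card ({x\<in>E'. u \<in> g x} \<union> {x\<in>E. u \<in> f x \<and> v \<in> f x})"
      unfolding deg_def using finE' finite_E XE by (intro card_mono) (auto simp: X_def)
    also have "\<dots> \<le> deg E' g u + card {x\<in>E. u \<in> f x \<and> v \<in> f x}"
      unfolding deg_def by (rule card_Un_le)
    finally show ?thesis using unsat codeg_le[OF \<open>u \<noteq> v\<close>] by linarith
  next
    case False
    then have "{x\<in>E' \<union> X. u \<in> ?g x} = {x\<in>E'. u \<in> g x}" by auto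
    then show ?thesis using dg[of u] unfolding deg_def by simp
  qed
  have "card (E' \<union> X) = card E' + card X" using finE' finX disj by (rule card_Un_disjoint)
  moreover have "card (insert v S) = Suc (card S)" using v A finite_V
    by (subst card_insert_disjoint) (auto intro: finite_subset)
  moreover have "\<beta> * D \<le> real (card X)" using large unfolding X_def deg_def .
  ultimately have "real (card (insert v S)) * \<beta> * D \<le> real (card (E' \<union> X))"
    using cE by (simp add: algebra_simps)
  then show ?thesis using A XE v wit' dg' unfolding link_state_def by auto
qed

text \<open>While some undecided vertex \<open>v\<close> has large active degree, branch on whether \<open>v \<in> I\<close>. Both branches
decide \<open>v\<close>, and the positive one uses up one of the \<open>J\<close> permitted choices; hence the walk has at most
\<open>(|A| + 1)\<^sup>j\<close> leaves when \<open>j\<close> choices remain. It stops once \<open>J\<close> vertices are chosen or all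
active degrees are small.\<close>

lemma coverable_by_terminal_states:
  assumes terminal: "\<And>A S E' g. link_state \<beta> \<tau> A S E' g \<Longrightarrow> card S \<le> J \<Longrightarrow>
      card S = J \<or> (\<forall>v\<in>A. real (deg (active \<tau> A E' g) f v) < \<beta> * D) \<Longrightarrow>
      coverable {I. I \<subseteq> V \<and> edge_free E f I \<and> S \<subseteq> I \<and> I \<subseteq> A \<union> S} G P"
    and "link_state \<beta> \<tau> A S E' g" "card S + j = J"
  shows "coverable {I. I \<subseteq> V \<and> edge_free E f I \<and> S \<subseteq> I \<and> I \<subseteq> A \<union> S} ((card A + 1) ^ j * G) P"
  using assms(2,3)
proof (induction "card A" arbitrary: A S E' g j rule: less_induct)
  case less
  let ?\<I> = "\<lambda>A S. {I. I \<subseteq> V \<and> edge_free E f I \<and> S \<subseteq> I \<and> I \<subseteq> A \<union> S}"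
  have st: "A \<subseteq> V" "S \<subseteq> V" "A \<inter> S = {}" using less.prems(1) unfolding link_state_def by auto
  have finA: "finite A" using st finite_V finite_subset by blast
  show ?case
  proof (cases "card S = J \<or> (\<forall>v\<in>A. real (deg (active \<tau> A E' g) f v) < \<beta> * D)")
    case True
    then have "coverable (?\<I> A S) G P" using terminal less.prems by force
    then show ?thesis by (rule coverable_mono) auto
  next
    case False
    then obtain v where v: "v \<in> A" "\<beta> * D \<le> real (deg (active \<tau> A E' g) f v)" by force
    obtain j' where j': "j = Suc j'" using False less.prems(2) by (cases j) auto
    obtain a where a: "card A = Suc a" "card (A - {v}) = a" using v(1) finA
      by (metis card_Suc_Diff1 that)
    have vS: "v \<notin> S" using v st by auto
    have out: "coverable (?\<I> (A - {v}) S) ((a + 1) ^ j * G) P"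
      using less.hyps[of "A - {v}" S E' g j] link_state_remove[OF less.prems(1)] less.prems(2) a by simp
    have "card (insert v S) + j' = J" using j' less.prems(2) vS st finite_V
      by (metis add_Suc add_Suc_right card_insert_disjoint finite_subset)
    then have "in": "coverable (?\<I> (A - {v}) (insert v S)) ((a + 1) ^ j' * G) P"
      using less.hyps[OF _ link_state_add[OF less.prems(1) v]] a by simp
    have "?\<I> A S \<subseteq> ?\<I> (A - {v}) S \<union> ?\<I> (A - {v}) (insert v S)" by auto
    moreover have "(a + 1) ^ j * G + (a + 1) ^ j' * G \<le> (card A + 1) ^ j * G"
    proof -
      have "(a + 1) ^ j + (a + 1) ^ j' = (a + 2) * (a + 1) ^ j'" by (simp add: j' algebra_simps)
      also have "\<dots> \<le> (a + 2) * (a + 2) ^ j'" by (intro mult_left_mono power_mono) auto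
      finally show ?thesis by (simp add: a j' distrib_right[symmetric] del: power_Suc mult_Suc)
         (metis power_Suc add_mult_distrib mult_le_mono1)
    qed
    ultimately show ?thesis by (intro coverable_mono[OF coverable_Un[OF out "in"]])
  qed
qed

lemma link_edge:
  assumes "link_state \<beta> \<tau> A S E' g" "x \<in> E'"
  shows "x \<in> E" "g x \<subseteq> f x" "card (g x) = s - 1"
proof -
  obtain v where v: "v \<in> f x" "g x = f x - {v}" and xE: "x \<in> E"
    using assms unfolding link_state_def by blast
  then show "x \<in> E" "g x \<subseteq> f x" "card (g x) = s - 1" using edge[OF xE] by auto
qed

text \<open>When the walk stops because all active degrees are small, only few edges are active, so at least
\<open>\<epsilon> D N / 2\<close> edges were lost. An edge is lost only by meeting a discarded, a chosen or a saturated vertex, and each such vertex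
accounts for at most \<open>D\<close> edges. So either a constant proportion of the vertices has been decided, or there
are many saturated vertices, and then the link hypergraph has many edges.\<close>

lemma terminal_state_cases:
  assumes st: "link_state (\<epsilon> / 2) \<tau> A S E' g" and "0 < s" "0 < D" "0 < \<tau>" "0 < \<epsilon>"
    and N: "real (card V) \<le> N" and E: "\<epsilon> * D * N \<le> real (card E)"
    and low: "\<forall>v\<in>A. real (deg (active \<tau> A E' g) f v) < \<epsilon> / 2 * D"
  shows "real (card A) \<le> real (card V) - \<epsilon> / 4 * N \<or>
    \<epsilon> / 4 * N * (\<tau> * D) \<le> real (s - 1) * real (card E')"
proof -
  have A: "A \<subseteq> V" "S \<subseteq> V" "E' \<subseteq> E" using st unfolding link_state_def by auto
  have fin: "finite A" "finite E'" using A finite_V finite_E finite_subset by blast+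
  define Sat where "Sat = {u\<in>V. \<tau> * D \<le> real (deg E' g u)}"
  define Lost where "Lost = {x\<in>E. f x \<inter> ((V - A) \<union> Sat) \<noteq> {}}"
  let ?act = "active \<tau> A E' g"
  have finL: "finite ((V - A) \<union> Sat)" "finite Sat" using finite_V unfolding Sat_def by auto
  have act_E: "?act \<subseteq> E" unfolding active_def by auto
  have "E \<subseteq> ?act \<union> Lost"
  proof
    fix x assume x: "x \<in> E"
    then have "f x \<subseteq> V" using edge by blast
    then show "x \<in> ?act \<union> Lost" using x unfolding active_def Lost_def Sat_def
      by (auto simp: not_less)
  qed
  then have "card E \<le> card (?act \<union> Lost)"
    using act_E finite_E unfolding Lost_def by (intro card_mono) (auto intro: finite_subset)
  also have "\<dots> \<le> card ?act + card Lost" by (rule card_Un_le)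
  finally have split: "real (card E) \<le> real (card ?act) + real (card Lost)" by linarith
  have "real (card ?act) \<le> \<epsilon> / 2 * D * real (card A)"
  proof (rule card_edges_meeting_le)
    show "finite ?act" using act_E finite_E finite_subset by blast
    show "f x \<inter> A \<noteq> {}" if "x \<in> ?act" for x
    proof -
      have "f x \<subseteq> A" "card (f x) = s" using that act_E edge unfolding active_def by auto
      then show ?thesis using \<open>0 < s\<close> by (auto simp: Int_absorb2)
    qed
  qed (use fin low in \<open>auto intro: less_imp_le\<close>)
  also have "\<dots> \<le> \<epsilon> / 2 * D * N"
    using card_mono[OF finite_V A(1)] N assms(3,5) by (intro mult_left_mono) auto
  finally have act: "real (card ?act) \<le> \<epsilon> / 2 * D * N" .
  have "real (card Lost) \<le> D * real (card ((V - A) \<union> Sat))"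
  proof (rule card_edges_meeting_le)
    show "real (deg Lost f v) \<le> D" for v
      using deg_mono[OF finite_E, of Lost f v] deg_le[of v] unfolding Lost_def by force
  qed (use finite_E finL in \<open>auto simp: Lost_def\<close>)
  also have "\<dots> \<le> D * (real (card (V - A)) + real (card Sat))"
    using card_Un_le[of "V - A" Sat] assms(3) by (intro mult_left_mono) auto
  finally have "\<epsilon> * D * N \<le> \<epsilon> / 2 * D * N + D * (real (card (V - A)) + real (card Sat))"
    using split act E by linarith
  then have "D * (\<epsilon> / 2 * N) \<le> D * (real (card (V - A)) + real (card Sat))"
    by (simp add: algebra_simps)
  then have "\<epsilon> / 2 * N \<le> real (card (V - A)) + real (card Sat)" using assms(3) by simp
  moreover have "real (card (V - A)) = real (card V) - real (card A)"
    using A(1) fin(1) finite_V by (simp add: card_Diff_subset card_mono of_nat_diff)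
  moreover have "real (card Sat) * (\<tau> * D) \<le> real (s - 1) * real (card E')"
  proof -
    have "real (card Sat) * (\<tau> * D) \<le> (\<Sum>u\<in>Sat. real (deg E' g u))"
      by (rule sum_bounded_below) (simp add: Sat_def)
    also have "\<dots> \<le> (\<Sum>u\<in>V. real (deg E' g u))"
      using finite_V by (intro sum_mono2) (auto simp: Sat_def)
    also have "\<dots> = real ((s - 1) * card E')"
    proof -
      have "g x \<subseteq> V \<and> card (g x) = s - 1" if "x \<in> E'" for x
        using link_edge[OF st that] edge by blast
      then show ?thesis using sum_deg[OF finite_V fin(2), of g "s - 1"] by (simp flip: of_nat_sum)
    qed
    finally show ?thesis by simp
  qed
  ultimately show ?thesis
  proof -
    assume a: "\<epsilon> / 2 * N \<le> real (card (V - A)) + real (card Sat)"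
      "real (card (V - A)) = real (card V) - real (card A)"
      and b: "real (card Sat) * (\<tau> * D) \<le> real (s - 1) * real (card E')"
    show ?thesis
    proof (cases "\<epsilon> / 4 * N \<le> real (card Sat)")
      case True
      then have "\<epsilon> / 4 * N * (\<tau> * D) \<le> real (card Sat) * (\<tau> * D)"
        using assms(3,4) by (intro mult_right_mono) auto
      then show ?thesis using b by linarith
    next
      case False
      then show ?thesis using a by (simp add: algebra_simps)
    qed
  qed
qed

end

text \<open>For \<open>(s + 1)\<close>-uniform hypergraphs of edge density \<open>\<epsilon>\<close>, a container misses at least \<open>c N\<close> vertices. The
size \<open>N\<close> is a bound for the number of vertices that stays fixed while vertex sets shrink, and \<open>J\<close> is the
number of vertices that the walk may choose at each uniformity. The type argument records the types of
vertices and edge labels.\<close>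

definition container_constant :: "('v \<times> 'e) itself \<Rightarrow> nat \<Rightarrow> real \<Rightarrow> real \<Rightarrow> bool" where
  "container_constant T s \<epsilon> c \<longleftrightarrow> (\<forall>(V :: 'v set) (E :: 'e set) f D D2 N \<tau> J.
    hypergraph V E f (Suc s) D D2 \<and> 0 < D \<and> 0 < \<tau> \<and> \<tau> \<le> 1 \<and> D2 \<le> \<tau> ^ s * D \<and>
    real (card V) \<le> N \<and> \<tau> * N \<le> real J \<and> real J \<le> c * N \<and> \<epsilon> * D * N \<le> real (card E) \<longrightarrow>
    coverable {I. I \<subseteq> V \<and> edge_free E f I} ((card V + 1) ^ (J * s))
      (\<lambda>C. C \<subseteq> V \<and> real (card C) \<le> real (card V) - c * N))"

lemma container_constantD:
  fixes V :: "'v set" and E :: "'e set"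
  assumes "container_constant TYPE('v \<times> 'e) s \<epsilon> c"
    and "hypergraph V E f (Suc s) D D2" "0 < D" "0 < \<tau>" "\<tau> \<le> 1" "D2 \<le> \<tau> ^ s * D"
    and "real (card V) \<le> N" "\<tau> * N \<le> real J" "real J \<le> c * N" "\<epsilon> * D * N \<le> real (card E)"
  shows "coverable {I. I \<subseteq> V \<and> edge_free E f I} ((card V + 1) ^ (J * s))
      (\<lambda>C. C \<subseteq> V \<and> real (card C) \<le> real (card V) - c * N)"
  using assms(2-) by (intro assms(1)[unfolded container_constant_def, rule_format] conjI)

lemma container_constant_antimono:
  fixes T :: "('v \<times> 'e) itself"
  assumes cont: "container_constant T s \<epsilon> c" and le: "c' \<le> c"
  shows "container_constant T s \<epsilon> c'"
  unfolding container_constant_def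
proof (intro allI impI; elim conjE)
  fix V :: "'v set" and E :: "'e set" and f D D2 N \<tau> and J :: nat
  assume h: "hypergraph V E f (Suc s) D D2" "0 < D" "0 < \<tau>" "\<tau> \<le> 1" "D2 \<le> \<tau> ^ s * D"
    "real (card V) \<le> N" "\<tau> * N \<le> real J" "real J \<le> c' * N" "\<epsilon> * D * N \<le> real (card E)"
  have "0 \<le> N" using h(6) by linarith
  then have cN: "c' * N \<le> c * N" using le by (intro mult_right_mono)
  have "coverable {I. I \<subseteq> V \<and> edge_free E f I} ((card V + 1) ^ (J * s))
      (\<lambda>C. C \<subseteq> V \<and> real (card C) \<le> real (card V) - c * N)"
    by (rule container_constantD[OF _ h(1-7) order_trans[OF h(8) cN] h(9)])
      (use cont in \<open>simp add: container_constant_def\<close>)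
  then show "coverable {I. I \<subseteq> V \<and> edge_free E f I} ((card V + 1) ^ (J * s))
      (\<lambda>C. C \<subseteq> V \<and> real (card C) \<le> real (card V) - c' * N)"
  proof (rule coverable_mono)
    show "C \<subseteq> V \<and> real (card C) \<le> real (card V) - c' * N"
      if "C \<subseteq> V \<and> real (card C) \<le> real (card V) - c * N" for C using that cN by linarith
  qed simp_all
qed

text \<open>Induction on the uniformity. For \<open>1\<close>-uniform hypergraphs an edge-free set avoids all vertices of edges, and
these are at least \<open>\<epsilon> N\<close> many. For the step, run the walk with \<open>\<beta> = \<epsilon> / 2\<close>. If it ends with a dense link
hypergraph, the containers given by the induction hypothesis for that hypergraph serve. Otherwise it
stopped with \<open>A \<union> S\<close> small, and \<open>A \<union> S\<close> is itself a container.\<close>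

lemma hypergraph_container_lemma:
  fixes \<epsilon> :: real
  assumes "0 < \<epsilon>"
  shows "\<exists>c>0. container_constant TYPE('v \<times> 'e) s \<epsilon> c"
  using assms
proof (induction s arbitrary: \<epsilon>)
  case 0
  show ?case
    unfolding container_constant_def
  proof (intro exI[of _ \<epsilon>] conjI allI impI; (elim conjE)?)
    fix V :: "'v set" and E :: "'e set" and f D D2 N \<tau> and J :: nat
    assume hyp: "hypergraph V E f (Suc 0) D D2" and D: "0 < D" and E: "\<epsilon> * D * N \<le> real (card E)"
    interpret hypergraph V E f "Suc 0" D D2 by fact
    define U where "U = (\<Union>x\<in>E. f x)"
    have UV: "U \<subseteq> V" using edge unfolding U_def by blast
    have finU: "finite U" using UV finite_V finite_subset by blast
    have "real (card E) \<le> D * real (card U)"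
    proof (rule card_edges_meeting_le[OF finite_E finU deg_le])
      show "f x \<inter> U \<noteq> {}" if "x \<in> E" for x
      proof -
        have "f x \<noteq> {}" "f x \<subseteq> U" using edge[OF that] that unfolding U_def by auto
        then show ?thesis by auto
      qed
    qed
    then have "D * (\<epsilon> * N) \<le> D * real (card U)" using E by (simp add: algebra_simps)
    then have cU: "\<epsilon> * N \<le> real (card U)" using D by simp
    show "coverable {I. I \<subseteq> V \<and> edge_free E f I} ((card V + 1) ^ (J * 0))
      (\<lambda>C. C \<subseteq> V \<and> real (card C) \<le> real (card V) - \<epsilon> * N)"
    proof (rule coverable_singleton[where C = "V - U"])
      show "V - U \<subseteq> V \<and> real (card (V - U)) \<le> real (card V) - \<epsilon> * N"
        using cU UV finU finite_V by (simp add: card_Diff_subset card_mono of_nat_diff)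
    next
      fix I assume I: "I \<in> {I. I \<subseteq> V \<and> edge_free E f I}"
      have "I \<inter> U = {}"
      proof (rule ccontr)
        assume "I \<inter> U \<noteq> {}"
        then obtain x v where x: "x \<in> E" "v \<in> f x" "v \<in> I" unfolding U_def by auto
        then have "f x = {v}" using edge[OF x(1)] by (metis card_1_singletonE One_nat_def singletonD)
        then show False using x I unfolding edge_free_def by auto
      qed
      then show "I \<subseteq> V - U" using I by auto
    qed simp
  qed (use 0 in auto)
next
  case (Suc s)
  \<comment> \<open>the density that the link hypergraph has at least, both after J choices and with many saturated vertices\<close>
  define \<epsilon>' where "\<epsilon>' = \<epsilon> / (8 * real (Suc s))"
  have \<epsilon>'_pos: "0 < \<epsilon>'" using Suc.prems unfolding \<epsilon>'_def by simp
  obtain c where c: "0 < c" and IH: "container_constant TYPE('v \<times> 'e) s \<epsilon>' c"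
    using Suc.IH[OF \<epsilon>'_pos] by (elim exE conjE)
  \<comment> \<open>half of the gain eps/4 from the decided vertices pays for adding the chosen vertices back\<close>
  define c' where "c' = min c (\<epsilon> / 8)"
  have c': "0 < c'" "c' \<le> c" "c' \<le> \<epsilon> / 8" using c Suc.prems unfolding c'_def by auto
  show ?case
    unfolding container_constant_def
  proof (intro exI[of _ c'] conjI allI impI; (elim conjE)?)
    fix V :: "'v set" and E :: "'e set" and f D D2 N \<tau> and J :: nat
    assume hyp: "hypergraph V E f (Suc (Suc s)) D D2" and D: "0 < D" and \<tau>: "0 < \<tau>" "\<tau> \<le> 1"
      and D2: "D2 \<le> \<tau> ^ Suc s * D" and N: "real (card V) \<le> N" and J: "\<tau> * N \<le> real J" "real J \<le> c' * N"
      and E: "\<epsilon> * D * N \<le> real (card E)"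
    interpret hypergraph V E f "Suc (Suc s)" D D2 by fact
    let ?P = "\<lambda>C. C \<subseteq> V \<and> real (card C) \<le> real (card V) - c' * N"
    let ?\<I> = "\<lambda>A S. {I. I \<subseteq> V \<and> edge_free E f I \<and> S \<subseteq> I \<and> I \<subseteq> A \<union> S}"
    let ?G = "(card V + 1) ^ (J * s)"
    have N0: "0 \<le> N" using N by linarith
    have "\<tau> ^ Suc s \<le> \<tau>" using \<tau> power_decreasing[of 1 "Suc s" \<tau>] by simp
    then have "\<tau> ^ Suc s * D \<le> \<tau> * D" using D by (intro mult_right_mono) auto
    then have D2': "D2 \<le> \<tau> * D" using D2 by linarith
    have init: "link_state (\<epsilon> / 2) \<tau> V {} {} f"
      using D \<tau> D2_nonneg unfolding link_state_def deg_def by simp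
    have "coverable (?\<I> V {}) ((card V + 1) ^ J * ?G) ?P"
    proof (rule coverable_by_terminal_states[OF _ init])
      fix A S E' g
      assume st: "link_state (\<epsilon> / 2) \<tau> A S E' g" and "card S \<le> J" and
        halt: "card S = J \<or> (\<forall>v\<in>A. real (deg (active \<tau> A E' g) f v) < \<epsilon> / 2 * D)"
      have A: "A \<subseteq> V" "S \<subseteq> V" "A \<inter> S = {}" "E' \<subseteq> E"
        and cE': "real (card S) * (\<epsilon> / 2) * D \<le> real (card E')"
        and dE': "\<And>u. real (deg E' g u) \<le> \<tau> * D + D2"
        using st unfolding link_state_def by auto
      have fin: "finite A" "finite S" "finite E'" using A finite_V finite_E finite_subset by blast+
      show "coverable (?\<I> A S) ?G ?P"
      \<comment> \<open>dense link hypergraph: its degrees are at most 2 tau D, since D2 is at most tau D\<close>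
      proof (cases "\<epsilon>' * (2 * \<tau> * D) * N \<le> real (card E')")
        case True
        have "hypergraph V E' g (Suc s) (2 * \<tau> * D) D2"
        proof
          show "real (deg E' g v) \<le> 2 * \<tau> * D" for v using dE'[of v] D2' by linarith
          show "real (card {x\<in>E'. u \<in> g x \<and> v \<in> g x}) \<le> D2" if "u \<noteq> v" for u v
          proof -
            have "card {x\<in>E'. u \<in> g x \<and> v \<in> g x} \<le> card {x\<in>E. u \<in> f x \<and> v \<in> f x}"
              using link_edge[OF st] finite_E by (intro card_mono) auto
            then show ?thesis using codeg_le[OF that] by linarith
          qed
          show "g x \<subseteq> V \<and> card (g x) = Suc s" if "x \<in> E'" for x
            using link_edge[OF st that] edge by auto
        qed (use finite_V fin D2_nonneg in auto)
        moreover have "D2 \<le> \<tau> ^ s * (2 * \<tau> * D)"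
        proof -
          have "0 \<le> \<tau> ^ s * (\<tau> * D)" using \<tau> D by simp
          then show ?thesis using D2 by (simp add: mult.assoc mult.left_commute)
        qed
        moreover have "real J \<le> c * N" using J(2) mult_right_mono[OF c'(2) N0] by linarith
        moreover have "0 < 2 * \<tau> * D" using \<tau> D by simp
        ultimately have "coverable {I. I \<subseteq> V \<and> edge_free E' g I} ?G
            (\<lambda>C. C \<subseteq> V \<and> real (card C) \<le> real (card V) - c * N)"
          by (intro container_constantD[OF IH _ _ \<tau> _ N J(1) _ True])
        then show ?thesis
        proof (rule coverable_mono)
          show "?\<I> A S \<subseteq> {I. I \<subseteq> V \<and> edge_free E' g I}"
          proof (rule subsetI)
            fix I assume "I \<in> ?\<I> A S"
            then have I: "I \<subseteq> V" "edge_free E f I" "S \<subseteq> I" by auto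
            have "\<not> g x \<subseteq> I" if x: "x \<in> E'" for x
            proof
              obtain v where "v \<in> S" "g x = f x - {v}" "x \<in> E" using st x unfolding link_state_def by blast
              moreover assume "g x \<subseteq> I"
              ultimately have "f x \<subseteq> I" using I(3) by auto
              then show False using I(2) \<open>x \<in> E\<close> unfolding edge_free_def by blast
            qed
            then show "I \<in> {I. I \<subseteq> V \<and> edge_free E' g I}" using I(1) unfolding edge_free_def by blast
          qed
          have "c' * N \<le> c * N" using c'(2) N0 by (rule mult_right_mono)
          then show "?P C" if "C \<subseteq> V \<and> real (card C) \<le> real (card V) - c * N" for C
            using that by linarith
        qed simp
      next
        case False
        have nJ: "card S \<noteq> J"
        proof
          assume "card S = J"
          then have "\<tau> * N * (\<epsilon> / 2 * D) \<le> real (card S) * (\<epsilon> / 2 * D)"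
            using J(1) Suc.prems D by (intro mult_right_mono) auto
          moreover have "\<epsilon>' * (2 * \<tau> * D) * N \<le> \<tau> * N * (\<epsilon> / 2 * D)"
          proof -
            have "\<epsilon>' * 2 \<le> \<epsilon> / 2" using Suc.prems unfolding \<epsilon>'_def by (simp add: field_simps)
            then have "\<epsilon>' * 2 * (\<tau> * D * N) \<le> \<epsilon> / 2 * (\<tau> * D * N)"
              using \<tau> D N0 by (intro mult_right_mono) auto
            then show ?thesis by (simp add: algebra_simps)
          qed
          ultimately show False using cE' False by (simp add: mult.assoc)
        qed
        have "\<not> \<epsilon> / 4 * N * (\<tau> * D) \<le> real (Suc (Suc s) - 1) * real (card E')"
        proof
          assume "\<epsilon> / 4 * N * (\<tau> * D) \<le> real (Suc (Suc s) - 1) * real (card E')"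
          then have "\<epsilon> / 4 * N * (\<tau> * D) / real (Suc s) \<le> real (card E')"
            by (simp only: diff_Suc_1 pos_divide_le_eq of_nat_0_less_iff zero_less_Suc mult.commute)
          moreover have "\<epsilon> / 4 * N * (\<tau> * D) / real (Suc s) = \<epsilon>' * (2 * \<tau> * D) * N"
            unfolding \<epsilon>'_def by (simp add: field_simps)
          ultimately show False using False by simp
        qed
        then have cA: "real (card A) \<le> real (card V) - \<epsilon> / 4 * N"
          using terminal_state_cases[OF st _ D \<tau>(1) Suc.prems N E] nJ halt by blast
        show ?thesis
        proof (rule coverable_singleton[where C = "A \<union> S"])
          have "real (card (A \<union> S)) \<le> real (card A) + real J"
            using card_Un_le[of A S] \<open>card S \<le> J\<close> by linarith
          moreover have "2 * (c' * N) \<le> \<epsilon> / 4 * N"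
            using mult_right_mono[OF c'(3) N0] by simp
          ultimately show "?P (A \<union> S)" using cA J(2) A(1,2) by auto
        qed auto
      qed
    qed simp
    then show "coverable {I. I \<subseteq> V \<and> edge_free E f I} ((card V + 1) ^ (J * Suc s)) ?P"
      by (rule coverable_mono) (auto simp: power_add)
  qed (use c' in auto)
qed

lemma uniform_container_constant:
  assumes "0 < \<epsilon>"
  shows "\<exists>c>0. \<forall>s\<le>q. container_constant TYPE('v \<times> 'e) s \<epsilon> c"
proof (induction q)
  case 0
  have "\<exists>c>0. container_constant TYPE('v \<times> 'e) 0 \<epsilon> c"
    by (rule hypergraph_container_lemma[OF assms])
  then show ?case by simp
next
  case (Suc q)
  then obtain c where c: "0 < c" "\<forall>s\<le>q. container_constant TYPE('v \<times> 'e) s \<epsilon> c" by (elim exE conjE)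
  obtain c' where c': "0 < c'" "container_constant TYPE('v \<times> 'e) (Suc q) \<epsilon> c'"
  proof -
    have "\<exists>c>0. container_constant TYPE('v \<times> 'e) (Suc q) \<epsilon> c"
      by (rule hypergraph_container_lemma[OF assms])
    then show thesis using that by (elim exE conjE)
  qed
  have "container_constant TYPE('v \<times> 'e) s \<epsilon> (min c c')" if "s \<le> Suc q" for s
  proof (cases "s = Suc q")
    case True
    show ?thesis unfolding True by (rule container_constant_antimono[OF c'(2)]) simp
  next
    case False
    then have "container_constant TYPE('v \<times> 'e) s \<epsilon> c" using that c(2) by simp
    then show ?thesis by (rule container_constant_antimono) simp
  qed
  then show ?case using c(1) c'(1) by (intro exI[of _ "min c c'"]) simp
qed

text \<open>Sets that are not good are split into sets that are smaller by \<open>\<delta>\<close>; a set of size at most \<open>R \<delta>\<close> admits at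
most \<open>R\<close> successive splits.\<close>

lemma coverable_iterate:
  fixes \<delta> :: real
  assumes step: "\<And>U. U \<subseteq> V \<Longrightarrow> \<not> good U \<Longrightarrow>
      coverable {I\<in>\<I>. I \<subseteq> U} m (\<lambda>C. C \<subseteq> U \<and> real (card C) \<le> real (card U) - \<delta>)"
    and "finite V" "0 < \<delta>" "1 \<le> m"
    and "U \<subseteq> V" "real (card U) \<le> real R * \<delta>"
  shows "coverable {I\<in>\<I>. I \<subseteq> U} (m ^ R) (\<lambda>C. C \<subseteq> V \<and> good C)"
  using assms(5,6)
proof (induction R arbitrary: U)
  case 0
  show ?case
  proof (cases "good U")
    case True
    then show ?thesis using 0 by (intro coverable_singleton[where C = U]) auto
  next
    case False
    from step[OF 0(1) this] show ?thesis
    proof -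
      assume "coverable {I\<in>\<I>. I \<subseteq> U} m (\<lambda>C. C \<subseteq> U \<and> real (card C) \<le> real (card U) - \<delta>)"
      then obtain \<C> where C: "\<forall>C\<in>\<C>. C \<subseteq> U \<and> real (card C) \<le> real (card U) - \<delta>"
        "\<forall>I\<in>{I\<in>\<I>. I \<subseteq> U}. \<exists>C\<in>\<C>. I \<subseteq> C" unfolding coverable_def by metis
      \<comment> \<open>a container would have negative size, so the split shows that there is nothing to cover\<close>
      have "\<C> = {}"
      proof (rule ccontr)
        assume "\<C> \<noteq> {}"
        then obtain C where "C \<in> \<C>" by blast
        then have "real (card C) < 0" using C(1) 0 \<open>0 < \<delta>\<close> by force
        then show False by simp
      qed
      then have "{I\<in>\<I>. I \<subseteq> U} = {}" using C(2) by blast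
      then show ?thesis unfolding coverable_def by (intro exI[of _ "{}"]) simp
    qed
  qed
next
  case (Suc R)
  show ?case
  proof (cases "good U")
    case True
    then show ?thesis using Suc.prems \<open>1 \<le> m\<close> by (intro coverable_singleton[where C = U]) auto
  next
    case False
    have "coverable {I\<in>\<I>. I \<subseteq> U} (m * m ^ R) (\<lambda>C. C \<subseteq> V \<and> good C)"
    proof (rule coverable_refine[OF step[OF Suc.prems(1) False]])
      fix C assume C: "C \<subseteq> U \<and> real (card C) \<le> real (card U) - \<delta>"
      have "C \<subseteq> V" using C Suc.prems by blast
      moreover have "real (card C) \<le> real R * \<delta>" using C Suc.prems by (simp add: algebra_simps)
      ultimately have "coverable {I \<in> \<I>. I \<subseteq> C} (m ^ R) (\<lambda>C. C \<subseteq> V \<and> good C)"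
        by (rule Suc.IH)
      then show "coverable {I \<in> {I \<in> \<I>. I \<subseteq> U}. I \<subseteq> C} (m ^ R) (\<lambda>C. C \<subseteq> V \<and> good C)"
        by (rule coverable_mono) (simp_all add: Collect_mono)
    qed
    then show ?thesis by simp
  qed
qed

section \<open>Types and diagrams\<close>

lemma sat_map_fm: "sat M e (map_fm id h \<phi>) \<longleftrightarrow> sat M (e \<circ> h) \<phi>"
  by (induction \<phi>) (auto simp: comp_def)

lemma sat_cong:
  assumes "wf_fm L T \<phi>" "\<And>t. t \<in> T \<Longrightarrow> e t = e' t"
  shows "sat M e \<phi> \<longleftrightarrow> sat M e' \<phi>"
  using assms(1)
proof (induction \<phi>)
  case (Rel R ts)
  then have "map e ts = map e' ts" using assms(2) by (auto simp: tuples_def)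
  then show ?case by (simp only: sat.simps)
qed (use assms(2) in auto)

lemma map_fm_cong_wf:
  assumes "wf_fm L T \<phi>" "\<And>t. t \<in> T \<Longrightarrow> h t = h' t"
  shows "map_fm id h \<phi> = map_fm id h' \<phi>"
  using assms(1)
proof (induction \<phi>)
  case (Rel R ts)
  then have "map h ts = map h' ts" using assms(2) by (auto simp: tuples_def)
  then show ?case by simp
qed (use assms(2) in auto)

lemma wf_map_fm:
  assumes "wf_fm L T \<phi>" "\<And>t. t \<in> T \<Longrightarrow> h t \<in> T'"
  shows "wf_fm L T' (map_fm id h \<phi>)"
  using assms(1)
proof (induction \<phi>)
  case (Rel R ts)
  then show ?case using assms(2) by (auto simp: tuples_def)
qed (use assms(2) in auto)

lemma map_fm_comp: "map_fm id g (map_fm id h \<phi>) = map_fm id (g \<circ> h) \<phi>"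
  by (simp add: fm.map_comp)

lemma map_fm_ident_wf: "wf_fm L T \<phi> \<Longrightarrow> (\<And>t. t \<in> T \<Longrightarrow> h t = t) \<Longrightarrow> map_fm id h \<phi> = \<phi>"
  using map_fm_cong_wf[of L T \<phi> h id] by (simp add: fm.map_id)

text \<open>The constants that occur in a diagram or in an instance of a complete type can be read off from the
trivial equations that it contains.\<close>

definition supp :: "('s, 'v) fm set \<Rightarrow> 'v set" where
  "supp P = {a. Eq a a \<in> P}"

lemma Eq_image_map_fm: "Eq a b \<in> map_fm id g ` P \<longleftrightarrow> (\<exists>i j. Eq i j \<in> P \<and> g i = a \<and> g j = b)"
proof
  assume "Eq a b \<in> map_fm id g ` P"
  then obtain \<phi> where "\<phi> \<in> P" "Eq a b = map_fm id g \<phi>" by auto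
  then show "\<exists>i j. Eq i j \<in> P \<and> g i = a \<and> g j = b" by (cases \<phi>) auto
next
  assume "\<exists>i j. Eq i j \<in> P \<and> g i = a \<and> g j = b"
  then obtain i j where "Eq i j \<in> P" "g i = a" "g j = b" by blast
  then show "Eq a b \<in> map_fm id g ` P" by (metis fm.simps(25) image_eqI)
qed

lemma complete_type_obtain:
  fixes p :: "('s, nat) fm set"
  assumes "complete_qf_type L r p"
  obtains M :: "('s, nat) struc" and e where "p = {\<phi> \<in> qf_fms L {..<r}. sat M e \<phi>}"
proof -
  obtain M :: "('s, nat) struc" and e where M: "\<forall>\<phi>\<in>p. sat M e \<phi>"
    using assms unfolding complete_qf_type_def satisfiable_def by blast
  have "p = {\<phi> \<in> qf_fms L {..<r}. sat M e \<phi>}"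
    using assms M unfolding complete_qf_type_def by fastforce
  then show thesis by (rule that)
qed

lemma complete_type_props:
  fixes p :: "('s, nat) fm set"
  assumes "complete_qf_type L r p"
  shows "p \<subseteq> qf_fms L {..<r}" "i < r \<Longrightarrow> Eq i i \<in> p"
proof -
  show "p \<subseteq> qf_fms L {..<r}" using assms unfolding complete_qf_type_def by blast
  obtain M :: "('s, nat) struc" and e where "p = {\<phi> \<in> qf_fms L {..<r}. sat M e \<phi>}"
    using complete_type_obtain[OF assms] by blast
  then show "i < r \<Longrightarrow> Eq i i \<in> p" unfolding qf_fms_def by simp
qed

lemma finite_tuples: "finite V \<Longrightarrow> finite (tuples V n)"
  unfolding tuples_def using finite_lists_length_eq[of V n] by (simp add: conj_commute)

lemma card_dtuples_le: "finite V \<Longrightarrow> card (dtuples V n) \<le> card V ^ n"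
proof -
  assume V: "finite V"
  have "card (dtuples V n) \<le> card (tuples V n)"
    using finite_tuples[OF V] unfolding dtuples_def by (intro card_mono) auto
  also have "\<dots> = card V ^ n"
    unfolding tuples_def using card_lists_length_eq[OF V, of n] by (simp add: conj_commute)
  finally show ?thesis .
qed

text \<open>A complete type is determined by its atomic formulas, of which there are finitely many.\<close>

lemma finite_complete_types:
  fixes L :: "'s language"
  assumes "finite_language L"
  shows "finite {p :: ('s, nat) fm set. complete_qf_type L r p}"
proof -
  define At where "At = (\<lambda>(i, j). Eq i j) ` ({..<r} \<times> {..<r}) \<union>
    (\<Union>R\<in>symbols L. Rel R ` tuples {..<r} (arity L R))"
  have finAt: "finite At"
    using assms finite_tuples unfolding At_def finite_language_def by blast
  have "inj_on (\<lambda>p. p \<inter> At) {p. complete_qf_type L r p}"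
  proof (rule inj_onI)
    fix p p' assume "p \<in> {p. complete_qf_type L r p}" "p' \<in> {p. complete_qf_type L r p}"
      and eq: "p \<inter> At = p' \<inter> At"
    then have cp: "complete_qf_type L r p" "complete_qf_type L r p'" by auto
    obtain M :: "('s, nat) struc" and e where M: "p = {\<phi> \<in> qf_fms L {..<r}. sat M e \<phi>}"
      using complete_type_obtain[OF cp(1)] by blast
    obtain M' :: "('s, nat) struc" and e' where M': "p' = {\<phi> \<in> qf_fms L {..<r}. sat M' e' \<phi>}"
      using complete_type_obtain[OF cp(2)] by blast
    have atom: "sat M e \<phi> \<longleftrightarrow> sat M' e' \<phi>" if "\<phi> \<in> At" "wf_fm L {..<r} \<phi>" for \<phi>
    proof -
      have "\<phi> \<in> p \<longleftrightarrow> \<phi> \<in> p'" using eq that(1) by blast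
      then show ?thesis using that(2) unfolding M M' qf_fms_def by simp
    qed
    have "sat M e \<phi> \<longleftrightarrow> sat M' e' \<phi>" if "wf_fm L {..<r} \<phi>" for \<phi>
      using that
    proof (induction \<phi>)
      case (Eq i j)
      then have "Eq i j \<in> At" unfolding At_def by force
      then show ?case using atom[OF _ Eq] by blast
    next
      case (Rel R ts)
      then have "Rel R ts \<in> At" unfolding At_def by auto
      then show ?case using atom[OF _ Rel] by blast
    qed auto
    then show "p = p'" unfolding M M' qf_fms_def by auto
  qed
  then show ?thesis
    by (rule inj_on_finite[of _ _ "Pow At"]) (use finAt in auto)
qed

lemma inst_map:
  assumes "p \<subseteq> qf_fms L {..<r}" "length as = r"
  shows "map_fm id g ` inst p as = inst p (map g as)"
proof -
  have "map_fm id g (map_fm id ((!) as) \<phi>) = map_fm id ((!) (map g as)) \<phi>" if "\<phi> \<in> p" for \<phi>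
    unfolding map_fm_comp
    by (rule map_fm_cong_wf[of L "{..<r}"]) (use that assms in \<open>auto simp: qf_fms_def\<close>)
  then show ?thesis unfolding inst_def image_image by simp
qed

lemma supp_inst:
  assumes "complete_qf_type L r p" "length as = r"
  shows "supp (inst p as) = set as"
proof (intro set_eqI iffI)
  fix a assume "a \<in> supp (inst p as)"
  then obtain i j where ij: "Eq i j \<in> p" "as ! i = a"
    unfolding supp_def inst_def mem_Collect_eq Eq_image_map_fm by blast
  then have "i < r" using complete_type_props(1)[OF assms(1)] unfolding qf_fms_def by auto
  then show "a \<in> set as" using ij assms(2) by auto
next
  fix a assume "a \<in> set as"
  then obtain i where "i < r" "as ! i = a" using assms(2) by (auto simp: in_set_conv_nth)
  then show "a \<in> supp (inst p as)"
    using complete_type_props(2)[OF assms(1)] unfolding supp_def inst_def mem_Collect_eq Eq_image_map_fm by blast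
qed

lemma S_types_complete: "p \<in> S_types L r \<B> \<Longrightarrow> complete_qf_type L r p"
  unfolding S_types_def by simp

lemma Diag_eq_inst:
  assumes "length as = r"
  shows "Diag L M (set as) = inst {\<phi> \<in> qf_fms L {..<r}. sat M ((!) as) \<phi>} as"
proof (intro set_eqI iffI)
  fix \<phi> assume "\<phi> \<in> Diag L M (set as)"
  then have wf: "wf_fm L (set as) \<phi>" and sat: "sat M (\<lambda>a. a) \<phi>" unfolding Diag_def qf_fms_def by auto
  have "\<forall>a\<in>set as. \<exists>i<r. as ! i = a" using assms by (auto simp: in_set_conv_nth)
  then obtain idx where idx: "\<And>a. a \<in> set as \<Longrightarrow> idx a < r \<and> as ! idx a = a" by metis
  let ?\<psi> = "map_fm id idx \<phi>"
  have invert: "map_fm id ((!) as) ?\<psi> = \<phi>"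
    unfolding map_fm_comp by (rule map_fm_ident_wf[OF wf]) (use idx in auto)
  have "wf_fm L {..<r} ?\<psi>" by (rule wf_map_fm[OF wf]) (use idx in auto)
  moreover have "sat M ((!) as) ?\<psi>"
    using sat sat_map_fm[of M "\<lambda>a. a" "(!) as" ?\<psi>] unfolding invert by (simp add: comp_def)
  ultimately show "\<phi> \<in> inst {\<phi> \<in> qf_fms L {..<r}. sat M ((!) as) \<phi>} as"
    unfolding inst_def qf_fms_def using invert by (metis (mono_tags, lifting) image_eqI mem_Collect_eq)
next
  fix \<phi> assume "\<phi> \<in> inst {\<phi> \<in> qf_fms L {..<r}. sat M ((!) as) \<phi>} as"
  then obtain \<psi> where \<psi>: "wf_fm L {..<r} \<psi>" "sat M ((!) as) \<psi>" "\<phi> = map_fm id ((!) as) \<psi>"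
    unfolding inst_def qf_fms_def by auto
  have "wf_fm L (set as) \<phi>" unfolding \<psi>(3) by (rule wf_map_fm[OF \<psi>(1)]) (use assms in auto)
  moreover have "sat M (\<lambda>a. a) \<phi>" using \<psi>(2) unfolding \<psi>(3) sat_map_fm by (simp add: comp_def)
  ultimately show "\<phi> \<in> Diag L M (set as)" unfolding Diag_def qf_fms_def by simp
qed

text \<open>Satisfiability asks for assignments of all terms, whereas only those over finitely many terms are relevant;
this fills in the rest.\<close>

lemma extend_assignment:
  assumes "domain M \<noteq> {}" "\<And>t. t \<in> T \<Longrightarrow> e t \<in> domain M"
  obtains e' where "range e' \<subseteq> domain M" "\<And>t. t \<in> T \<Longrightarrow> e' t = e t"
proof -
  obtain w where "w \<in> domain M" using assms(1) by blast
  then have "range (\<lambda>t. if t \<in> T then e t else w) \<subseteq> domain M" using assms(2) by auto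
  then show thesis by (rule that) simp
qed

lemma type_of_tuple_in_S_types:
  fixes M :: "('s, nat) struc" and \<F> :: "('s, nat) struc set"
  assumes M: "is_struc L M" "finite (domain M)" "is_free L \<F> M" and as: "as \<in> dtuples (domain M) r"
  shows "{\<phi> \<in> qf_fms L {..<r}. sat M ((!) as) \<phi>} \<in> S_types L r (Forb L \<F>)" (is "?p \<in> _")
proof -
  have len: "length as = r" "distinct as" "set as \<subseteq> domain M"
    using as unfolding dtuples_def tuples_def by auto
  have ne: "domain M \<noteq> {}" using M(1) unfolding is_struc_def by blast
  obtain e where e: "range e \<subseteq> domain M" "\<And>i. i \<in> {..<r} \<Longrightarrow> e i = as ! i"
    by (rule extend_assignment[OF ne, of "{..<r}" "(!) as"]) (use len in auto)
  have "sat M e \<phi>" if "\<phi> \<in> ?p" for \<phi>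
    using that sat_cong[of L "{..<r}" \<phi> e "(!) as" M] e(2) unfolding qf_fms_def by blast
  then have "satisfiable L ?p" unfolding satisfiable_def using M(1) e(1) by blast
  moreover have "\<phi> \<in> ?p \<or> Neg \<phi> \<in> ?p" if "\<phi> \<in> qf_fms L {..<r}" for \<phi>
    using that unfolding qf_fms_def by simp
  ultimately have "complete_qf_type L r ?p" unfolding complete_qf_type_def by blast
  moreover have "proper_type r ?p"
    unfolding proper_type_def qf_fms_def using len by (simp add: nth_eq_iff_index_eq)
  moreover have "M \<in> Forb L \<F>" using M unfolding Forb_def by simp
  moreover have "realized_in r ?p M"
    unfolding realized_in_def using as unfolding dtuples_def by auto
  ultimately show ?thesis unfolding S_types_def by blast
qed

lemma nsets_enumerate:
  assumes "A \<in> nsets W r"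
  obtains as where "as \<in> dtuples W r" "set as = A"
proof -
  have A: "finite A" "card A = r" "A \<subseteq> W" using assms unfolding nsets_def by auto
  obtain as where as: "set as = A" "distinct as" using finite_distinct_list[OF A(1)] by blast
  then have "as \<in> dtuples W r" using A distinct_card[OF as(2)] unfolding dtuples_def tuples_def by simp
  then show thesis using as(1) by (rule that)
qed

text \<open>This places \<open>\<F>\<close>-free structures in the hypergraph setting: their diagrams are vertices.\<close>

lemma Diag_obtain_inst:
  fixes M :: "('s, nat) struc" and \<F> :: "('s, nat) struc set"
  assumes M: "is_struc L M" "finite (domain M)" "is_free L \<F> M" and A: "A \<in> nsets (domain M) r"
  obtains p as where "p \<in> S_types L r (Forb L \<F>)" "as \<in> dtuples (domain M) r" "set as = A"
    "Diag L M A = inst p as"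
proof -
  obtain as where as: "as \<in> dtuples (domain M) r" "set as = A" using nsets_enumerate[OF A] by blast
  have "length as = r" using as(1) unfolding dtuples_def tuples_def by simp
  from Diag_eq_inst[OF this, of L M] show thesis
    using that[OF type_of_tuple_in_S_types[OF M as(1)] as] as(2) by simp
qed

section \<open>Templates as sets of type instances\<close>

definition template_of where
  "template_of L r \<B> W U = \<lparr>domain = W,
     interp = (\<lambda>p. if p \<in> S_types L r \<B> then {as \<in> dtuples W r. inst p as \<in> U} else {})\<rparr>"

lemma domain_template_of [simp]: "domain (template_of L r \<B> W U) = W"
  unfolding template_of_def by simp

lemma in_interp_template_of:
  "as \<in> interp (template_of L r \<B> W U) p \<longleftrightarrow> p \<in> S_types L r \<B> \<and> as \<in> dtuples W r \<and> inst p as \<in> U"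
  unfolding template_of_def by simp

text \<open>Renaming variables before substituting is the same as permuting the tuple that is substituted. Hence
condition (2) of templates holds for every set \<open>U\<close>, as \<open>R\<^sub>p(a)\<close> and \<open>R\<^bsub>p'\<^esub>(\<mu>(a))\<close> are
decided by the same member of \<open>U\<close>.\<close>

lemma inst_permute:
  assumes "p' \<subseteq> qf_fms L {..<r}" "\<mu> permutes {..<r}" "length as = r"
  shows "inst (inst p' (permute_tuple \<mu> [0..<r])) as = inst p' (permute_tuple \<mu> as)"
proof -
  have "map_fm id ((!) as) (map_fm id ((!) (permute_tuple \<mu> [0..<r])) \<phi>)
      = map_fm id ((!) (permute_tuple \<mu> as)) \<phi>" if "\<phi> \<in> p'" for \<phi>
    unfolding map_fm_comp
  proof (rule map_fm_cong_wf[of L "{..<r}"])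
    show "wf_fm L {..<r} \<phi>" using that assms(1) unfolding qf_fms_def by auto
    fix i assume i: "i \<in> {..<r}"
    then have "\<mu> i < r" using permutes_in_image[OF assms(2)] by simp
    then show "((!) as \<circ> (!) (permute_tuple \<mu> [0..<r])) i = permute_tuple \<mu> as ! i"
      using i assms(3) unfolding permute_tuple_def by simp
  qed
  then show ?thesis unfolding inst_def image_image by simp
qed

lemma permute_tuple_dtuples:
  assumes "\<mu> permutes {..<r}" "as \<in> dtuples W r"
  shows "permute_tuple \<mu> as \<in> dtuples W r"
proof -
  have as: "length as = r" "distinct as" "set as \<subseteq> W" using assms(2) unfolding dtuples_def tuples_def by auto
  have lt: "\<mu> i < r" if "i < r" for i using permutes_in_image[OF assms(1), of i] that by simp
  have "inj_on (\<lambda>i. as ! \<mu> i) {0..<r}"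
  proof (rule inj_onI)
    fix i j assume "i \<in> {0..<r}" "j \<in> {0..<r}" "as ! \<mu> i = as ! \<mu> j"
    then have "\<mu> i = \<mu> j" using as lt by (simp add: nth_eq_iff_index_eq)
    then show "i = j" using permutes_inj[OF assms(1)] by (simp add: inj_eq)
  qed
  then show ?thesis using as lt unfolding permute_tuple_def dtuples_def tuples_def
    by (force simp: distinct_map)
qed

lemma template_template_of:
  assumes "W \<noteq> {}" and full: "\<And>A. A \<in> nsets W r \<Longrightarrow> \<exists>as\<in>dtuples W r. \<exists>p\<in>S_types L r \<B>. set as = A \<and> inst p as \<in> U"
  shows "template L r \<B> (template_of L r \<B> W U)"
proof -
  have "is_struc (type_language L r \<B>) (template_of L r \<B> W U)"
    unfolding is_struc_def type_language_def template_of_def using assms(1) by (auto simp: dtuples_def)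
  moreover have "\<exists>as\<in>dtuples W r. \<exists>p\<in>S_types L r \<B>. set as = A \<and> as \<in> interp (template_of L r \<B> W U) p"
    if "A \<in> nsets W r" for A
    using full[OF that] unfolding in_interp_template_of by blast
  ultimately have "complete_struc L r \<B> (template_of L r \<B> W U)"
    unfolding complete_struc_def by simp
  moreover have "as \<in> interp (template_of L r \<B> W U) p \<longleftrightarrow> permute_tuple \<mu> as \<in> interp (template_of L r \<B> W U) p'"
    if "p \<in> S_types L r \<B>" "p' \<in> S_types L r \<B>" "\<mu> permutes {..<r}"
      "p = inst p' (permute_tuple \<mu> [0..<r])" "as \<in> dtuples W r" for p p' \<mu> as
  proof -
    have "length as = r" using that(5) unfolding dtuples_def tuples_def by simp
    then have "inst p as = inst p' (permute_tuple \<mu> as)"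
      using inst_permute[OF complete_type_props(1)[OF S_types_complete[OF that(2)]] that(3)] that(4) by simp
    then show ?thesis unfolding in_interp_template_of
      using that permute_tuple_dtuples[OF that(3,5)] by simp
  qed
  moreover have "as \<notin> interp (template_of L r \<B> W U) p" if "as \<in> tuples W r - dtuples W r" for p as
    using that by (simp add: in_interp_template_of)
  ultimately show ?thesis unfolding template_def domain_template_of by blast
qed

text \<open>Completeness of the template is inherited from the structure: the diagrams of \<open>M\<close> put at least one vertex over
each \<open>r\<close>-subset.\<close>

lemma full_subpattern_template_of:
  fixes M :: "('s, nat) struc" and \<F> :: "('s, nat) struc set"
  assumes M: "is_struc L M" "finite W" "domain M = W" "is_free L \<F> M"
    and U: "Diag L M ` nsets W r \<subseteq> U"
  shows "template L r (Forb L \<F>) (template_of L r (Forb L \<F>) W U)"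
    and "full_subpattern L r (Forb L \<F>) M (template_of L r (Forb L \<F>) W U)"
proof -
  have ne: "W \<noteq> {}" using M(1,3) unfolding is_struc_def by blast
  have *: "\<exists>as\<in>dtuples W r. \<exists>p\<in>S_types L r (Forb L \<F>). set as = A \<and> Diag L M A = inst p as"
    if A: "A \<in> nsets W r" for A
    by (rule Diag_obtain_inst[OF M(1) _ M(4), of A r]) (use M A in auto)
  show temp: "template L r (Forb L \<F>) (template_of L r (Forb L \<F>) W U)"
  proof (rule template_template_of[OF ne])
    show "\<exists>as\<in>dtuples W r. \<exists>p\<in>S_types L r (Forb L \<F>). set as = A \<and> inst p as \<in> U"
      if "A \<in> nsets W r" for A using *[OF that] U that by (metis image_subset_iff)
  qed
  have "choice_fun L r (Forb L \<F>) (template_of L r (Forb L \<F>) W U) (Diag L M)"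
    unfolding choice_fun_def domain_template_of
  proof
    fix A assume A: "A \<in> nsets W r"
    then obtain as p where ap: "as \<in> dtuples W r" "p \<in> S_types L r (Forb L \<F>)" "set as = A"
      "Diag L M A = inst p as" using * by blast
    then have "inst p as \<in> U" using U A by (metis image_subset_iff)
    then show "Diag L M A \<in> S_const L r W (Forb L \<F>) \<and>
        Diag L M A \<in> Ch L r (Forb L \<F>) (template_of L r (Forb L \<F>) W U) A"
      unfolding S_const_def Ch_def domain_template_of in_interp_template_of using ap by blast
  qed
  then show "full_subpattern L r (Forb L \<F>) M (template_of L r (Forb L \<F>) W U)"
    using temp M unfolding full_subpattern_def template_def by auto
qed

section \<open>Copies of patterns and the edges they give\<close>

definition copies :: "'s language \<Rightarrow> ('s, 'w) struc \<Rightarrow> ('s, 'v) struc \<Rightarrow> 'v set set" where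
  "copies L B C = {X. X \<subseteq> domain C \<and> X \<noteq> {} \<and> isomorphic L (induced C X) B}"

lemma prob_eq_copies:
  "prob L B C = real (card (copies L B C)) / real (card (domain C) choose card (domain B))"
proof -
  have "{N \<in> substrucs C. isomorphic L N B} = induced C ` copies L B C"
    unfolding substrucs_def copies_def by auto
  moreover have "inj_on (induced C) (copies L B C)"
    unfolding induced_def by (auto intro: inj_onI)
  ultimately show ?thesis unfolding prob_def by (simp add: card_image)
qed

lemma copies_obtain:
  assumes "X \<in> copies L B C"
  obtains g where "bij_betw g (domain B) X" "\<And>R bs. R \<in> symbols L \<Longrightarrow> bs \<in> tuples (domain B) (arity L R) \<Longrightarrow>
    bs \<in> interp B R \<Longrightarrow> map g bs \<in> interp C R"
proof -
  obtain h where h: "bij_betw h X (domain B)"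
    and iso: "\<And>R as. R \<in> symbols L \<Longrightarrow> as \<in> tuples X (arity L R) \<Longrightarrow> as \<in> interp (induced C X) R \<longleftrightarrow> map h as \<in> interp B R"
  proof -
    have "isomorphic L (induced C X) B" "domain (induced C X) = X"
      using assms unfolding copies_def by (auto simp: induced_def)
    then show thesis using that unfolding isomorphic_def by metis
  qed
  define g where "g = inv_into X h"
  have g: "bij_betw g (domain B) X" unfolding g_def using h by (rule bij_betw_inv_into)
  show thesis
  proof (rule that[OF g])
    fix R bs assume R: "R \<in> symbols L" and bs: "bs \<in> tuples (domain B) (arity L R)" "bs \<in> interp B R"
    have "map h (map g bs) = bs"
      using bs(1) h unfolding g_def tuples_def map_map
      by (intro map_idI) (auto simp: bij_betw_inv_into_right)
    moreover have "map g bs \<in> tuples X (arity L R)"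
      using bs(1) g unfolding tuples_def bij_betw_def by auto
    ultimately have "map g bs \<in> interp (induced C X) R" using iso[OF R] bs(2) by simp
    then show "map g bs \<in> interp C R" unfolding induced_def by simp
  qed
qed

lemma card_copy: "X \<in> copies L B C \<Longrightarrow> card X = card (domain B)"
  by (erule copies_obtain) (simp add: bij_betw_same_card)

lemma supp_image_Diag: "supp (map_fm id g ` Diag L M A) = g ` A" if "inj_on g A"
proof -
  have "Eq i j \<in> Diag L M A \<longleftrightarrow> i \<in> A \<and> j \<in> A \<and> i = j" for i j
    unfolding Diag_def qf_fms_def by auto
  then show ?thesis unfolding supp_def Eq_image_map_fm by auto
qed

text \<open>As all arities are at most \<open>r \<le> |F|\<close>, every tuple of \<open>F\<close> lies in an \<open>r\<close>-subset. So if all transported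
diagrams of \<open>F\<close> on \<open>r\<close>-subsets were diagrams of \<open>M\<close>, the map \<open>g\<close> would be an isomorphism onto a substructure.\<close>

lemma free_avoids_copy:
  assumes free: "is_free L \<F> M" and F: "F \<in> \<F>" "domain F \<noteq> {}" "finite (domain F)"
    and ar: "\<And>R. R \<in> symbols L \<Longrightarrow> arity L R \<le> r" and r: "r \<le> card (domain F)"
    and g: "bij_betw g (domain F) X" and X: "X \<subseteq> domain M"
  shows "\<not> (\<lambda>A. map_fm id g ` Diag L F A) ` nsets (domain F) r \<subseteq> Diag L M ` nsets (domain M) r"
proof
  assume sub: "(\<lambda>A. map_fm id g ` Diag L F A) ` nsets (domain F) r \<subseteq> Diag L M ` nsets (domain M) r"
  have key: "bs \<in> interp F R \<longleftrightarrow> map g bs \<in> interp M R"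
    if R: "R \<in> symbols L" and bs: "bs \<in> tuples (domain F) (arity L R)" for R bs
  proof -
    have len: "length bs = arity L R" "set bs \<subseteq> domain F" using bs unfolding tuples_def by auto
    have "card (set bs) \<le> r" using ar[OF R] len(1) card_length[of bs] by linarith
    then obtain A where A: "set bs \<subseteq> A" "A \<subseteq> domain F" "card A = r"
      using exists_subset_between[OF _ r len(2) F(3)] by blast
    have fA: "finite A" using A(2) F(3) finite_subset by blast
    then have nA: "A \<in> nsets (domain F) r" using A unfolding nsets_def by simp
    then obtain A' where A': "map_fm id g ` Diag L F A = Diag L M A'" using sub by blast
    have wf: "wf_fm L A (Rel R bs)" using R len A(1) by (simp add: tuples_def)
    have "sat M (\<lambda>a. a) (map_fm id g \<phi>)" if "\<phi> \<in> Diag L F A" for \<phi>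
    proof -
      have "map_fm id g \<phi> \<in> Diag L M A'" using A' that by blast
      then show ?thesis unfolding Diag_def by simp
    qed
    note hom = this
    have "Rel R bs \<in> Diag L F A" if "bs \<in> interp F R"
      using that wf unfolding Diag_def qf_fms_def by simp
    moreover have "Neg (Rel R bs) \<in> Diag L F A" if "bs \<notin> interp F R"
      using that wf unfolding Diag_def qf_fms_def by simp
    ultimately show ?thesis using hom[of "Rel R bs"] hom[of "Neg (Rel R bs)"] by auto
  qed
  define h where "h = inv_into (domain F) g"
  have h: "bij_betw h X (domain F)" unfolding h_def using g by (rule bij_betw_inv_into)
  have "isomorphic L (induced M X) F"
    unfolding isomorphic_def
  proof (intro exI[of _ h] conjI ballI)
    show "bij_betw h (domain (induced M X)) (domain F)" using h unfolding induced_def by simp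
    fix R as assume R: "R \<in> symbols L" and "as \<in> tuples (domain (induced M X)) (arity L R)"
    then have as: "set as \<subseteq> X" "length as = arity L R" unfolding tuples_def induced_def by auto
    have "map g (map h as) = as"
      using as(1) g unfolding h_def map_map
      by (intro map_idI) (auto simp: bij_betw_inv_into_right)
    moreover have "map h as \<in> tuples (domain F) (arity L R)"
      using as h unfolding tuples_def bij_betw_def by auto
    ultimately have "map h as \<in> interp F R \<longleftrightarrow> as \<in> interp M R" using key[OF R] by simp
    then show "as \<in> interp (induced M X) R \<longleftrightarrow> map h as \<in> interp F R"
      using as(1) unfolding induced_def by simp
  qed
  moreover have "X \<noteq> {}" using g F(2) unfolding bij_betw_def by blast
  ultimately show False using free F(1) X unfolding is_free_def substrucs_def by blast
qed

text \<open>The edge belonging to a copy of \<open>B\<close> consists of the diagrams of a structure \<open>F \<in> \<F>\<close> that is a full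
subpattern of \<open>B\<close>, transported to \<open>X\<close>. It lies in \<open>U\<close> because the choice function of \<open>F\<close> picks types
that hold in \<open>B\<close>.\<close>

lemma forb_pattern_edge:
  fixes \<F> :: "('s, nat) struc set" and U :: "('s, nat) fm set set"
  assumes B: "B \<in> forb_patterns L r \<F>" and fin: "\<And>F. F \<in> \<F> \<Longrightarrow> is_struc L F \<and> finite (domain F)"
    and ar: "\<And>R. R \<in> symbols L \<Longrightarrow> arity L R \<le> r"
    and X: "X \<in> copies (type_language L r (Forb L \<F>)) B (template_of L r (Forb L \<F>) W U)"
  shows "\<exists>Y. Y \<subseteq> U \<and> card Y = card (domain B) choose r \<and> (\<forall>v\<in>Y. supp v \<in> nsets X r) \<and> inj_on supp Y \<and>
    (\<forall>M. is_struc L M \<and> domain M = W \<and> is_free L \<F> M \<longrightarrow> \<not> Y \<subseteq> Diag L M ` nsets W r)"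
proof -
  let ?B = "Forb L \<F>"
  obtain F where F: "F \<in> \<F>" "r \<le> card (domain B)" "full_subpattern L r ?B F B"
    using B unfolding forb_patterns_def by blast
  have dF: "domain F = domain B" using F(3) unfolding full_subpattern_def by blast
  obtain \<chi> where \<chi>: "choice_fun L r ?B B \<chi>" "\<And>A. A \<in> nsets (domain B) r \<Longrightarrow> Diag L F A = \<chi> A"
    using F(3) unfolding full_subpattern_def by blast
  obtain g where g: "bij_betw g (domain B) X" and gi: "\<And>R bs. R \<in> symbols (type_language L r ?B) \<Longrightarrow>
      bs \<in> tuples (domain B) (arity (type_language L r ?B) R) \<Longrightarrow>
      bs \<in> interp B R \<Longrightarrow> map g bs \<in> interp (template_of L r ?B W U) R"
    using copies_obtain[OF X] by blast
  have finB: "finite (domain B)" using fin[OF F(1)] dF by simp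
  have XW: "X \<subseteq> W" using X unfolding copies_def by simp
  let ?t = "\<lambda>A. map_fm id g ` Diag L F A"
  define Y where "Y = ?t ` nsets (domain B) r"
  have supp_t: "supp (?t A) = g ` A" "A \<subseteq> domain B" if "A \<in> nsets (domain B) r" for A
  proof -
    show "A \<subseteq> domain B" using that unfolding nsets_def by simp
    then show "supp (?t A) = g ` A"
      using g by (intro supp_image_Diag) (metis bij_betw_def inj_on_subset)
  qed
  have inj_g: "inj_on g (domain B)" using g unfolding bij_betw_def by simp
  have inj: "A = A'" if "A \<in> nsets (domain B) r" "A' \<in> nsets (domain B) r" "supp (?t A) = supp (?t A')" for A A'
    using that supp_t inj_on_image_eq_iff[OF inj_g] by metis
  have "Y \<subseteq> U"
  proof
    fix v assume "v \<in> Y"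
    then obtain A where A: "A \<in> nsets (domain B) r" "v = ?t A" unfolding Y_def by blast
    then have "Diag L F A \<in> Ch L r ?B B A" using \<chi> unfolding choice_fun_def by simp
    then obtain p as where pa: "p \<in> S_types L r ?B" "as \<in> dtuples (domain B) r" "as \<in> interp B p"
      "Diag L F A = inst p as" unfolding Ch_def by blast
    have "map g as \<in> interp (template_of L r ?B W U) p"
      using gi[of p as] pa unfolding type_language_def dtuples_def by simp
    then have "inst p (map g as) \<in> U" unfolding in_interp_template_of by blast
    moreover have "v = inst p (map g as)"
      unfolding A(2) pa(4)
      using pa(2) by (intro inst_map[OF complete_type_props(1)[OF S_types_complete[OF pa(1)]]])
        (simp add: dtuples_def tuples_def)
    ultimately show "v \<in> U" by simp
  qed
  moreover have "card Y = card (domain B) choose r"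
  proof -
    have "inj_on ?t (nsets (domain B) r)" by (rule inj_onI) (use inj in auto)
    then have "card Y = card (nsets (domain B) r)" unfolding Y_def by (rule card_image)
    then show ?thesis by (simp add: card_nsets)
  qed
  moreover have "\<forall>v\<in>Y. supp v \<in> nsets X r"
  proof
    fix v assume "v \<in> Y"
    then obtain A where A: "A \<in> nsets (domain B) r" "v = ?t A" unfolding Y_def by blast
    have "card (g ` A) = card A" "g ` A \<subseteq> X" using supp_t(2)[OF A(1)] g inj_g
      by (auto simp: card_image inj_on_subset bij_betw_def)
    then show "supp v \<in> nsets X r" using A supp_t[OF A(1)] unfolding nsets_def by auto
  qed
  moreover have "inj_on supp Y" unfolding Y_def by (rule inj_onI) (use inj in auto)
  moreover have "\<not> Y \<subseteq> Diag L M ` nsets W r" if "is_struc L M" "domain M = W" "is_free L \<F> M" for M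
    unfolding Y_def using free_avoids_copy[OF that(3) F(1) _ _ ar, where g = g and X = X] that XW g F(2) dF fin[OF F(1)]
    unfolding is_struc_def by simp
  ultimately show ?thesis by blast
qed

text \<open>The edge belonging to a copy of an error consists of its two contradictory type instances. Their supports
differ, since together they cover more than \<open>r\<close> points; and a structure whose diagrams include both would
satisfy them jointly.\<close>

lemma error_edge:
  fixes \<B> :: "('s, nat) struc set" and U :: "('s, nat) fm set set"
  assumes B: "is_error L r \<B> l B" "r < l"
    and X: "X \<in> copies (type_language L r \<B>) B (template_of L r \<B> W U)"
  shows "\<exists>Y. Y \<subseteq> U \<and> card Y = 2 \<and> (\<forall>v\<in>Y. supp v \<in> nsets X r) \<and> inj_on supp Y \<and>
    (\<forall>M :: ('s, nat) struc. is_struc L M \<and> domain M = W \<longrightarrow> \<not> Y \<subseteq> Diag L M ` nsets W r)"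
proof -
  obtain as bs p q where dom: "finite (domain B)" "card (domain B) = l" "domain B = set as \<union> set bs"
    and ab: "as \<in> dtuples (domain B) r" "bs \<in> dtuples (domain B) r"
    and pq: "p \<in> S_types L r \<B>" "q \<in> S_types L r \<B>" "as \<in> interp B p" "bs \<in> interp B q"
    and unsat: "\<not> satisfiable L (inst p as \<union> inst q bs)"
    using B(1) unfolding is_error_def by blast
  obtain g where g: "bij_betw g (domain B) X" and gi: "\<And>R bs. R \<in> symbols (type_language L r \<B>) \<Longrightarrow>
      bs \<in> tuples (domain B) (arity (type_language L r \<B>) R) \<Longrightarrow>
      bs \<in> interp B R \<Longrightarrow> map g bs \<in> interp (template_of L r \<B> W U) R"
    using copies_obtain[OF X] by blast
  have len: "length as = r" "length bs = r" "distinct as" "distinct bs"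
    using ab unfolding dtuples_def tuples_def by auto
  have inj_g: "inj_on g (domain B)" using g unfolding bij_betw_def by simp
  have sub: "p \<subseteq> qf_fms L {..<r}" "q \<subseteq> qf_fms L {..<r}"
    using pq complete_type_props(1) S_types_complete by blast+
  let ?u = "inst p (map g as)" and ?v = "inst q (map g bs)"
  have su: "supp ?u = g ` set as" "supp ?v = g ` set bs"
    using supp_inst[OF S_types_complete[OF pq(1)], of "map g as"]
      supp_inst[OF S_types_complete[OF pq(2)], of "map g bs"] len by auto
  have "set as \<noteq> set bs" using dom B(2) len by (auto simp: distinct_card)
  then have ne: "supp ?u \<noteq> supp ?v" unfolding su
    using inj_on_image_eq_iff[OF inj_g] dom(3) by auto
  have XW: "X \<subseteq> W" using X unfolding copies_def by simp
  have "map g as \<in> interp (template_of L r \<B> W U) p" "map g bs \<in> interp (template_of L r \<B> W U) q"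
    using gi[of p as] gi[of q bs] pq ab unfolding type_language_def dtuples_def by auto
  then have uvU: "{?u, ?v} \<subseteq> U" unfolding in_interp_template_of by blast
  have "supp ?u \<in> nsets X r" "supp ?v \<in> nsets X r" unfolding su nsets_def
    using g inj_g len dom(3) by (auto simp: bij_betw_def card_image inj_on_Un distinct_card)
  moreover have "inj_on supp {?u, ?v}" using ne by auto
  moreover have "?u \<noteq> ?v" using ne by metis
  then have "card {?u, ?v} = 2" by simp
  moreover have "\<not> {?u, ?v} \<subseteq> Diag L M ` nsets W r" if M: "is_struc L M" "domain M = W" for M :: "('s, nat) struc"
  proof
    assume sub2: "{?u, ?v} \<subseteq> Diag L M ` nsets W r"
    have satM: "sat M (\<lambda>a. a) \<psi>" if "\<psi> \<in> ?u \<union> ?v" for \<psi>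
    proof -
      have all: "sat M (\<lambda>a. a) \<psi>" if "y \<in> Diag L M ` nsets W r" "\<psi> \<in> y" for y
        using that unfolding Diag_def by auto
      have "?u \<in> Diag L M ` nsets W r" "?v \<in> Diag L M ` nsets W r" using sub2 by simp_all
      then show ?thesis using that all by (elim UnE)
    qed
    have eq: "?u \<union> ?v = map_fm id g ` (inst p as \<union> inst q bs)"
      by (simp only: image_Un inst_map[OF sub(1) len(1)] inst_map[OF sub(2) len(2)])
    have neM: "domain M \<noteq> {}" using M(1) unfolding is_struc_def by blast
    obtain e where e: "range e \<subseteq> domain M" "\<And>t. t \<in> domain B \<Longrightarrow> e t = g t"
      by (rule extend_assignment[OF neM, of "domain B" g]) (use g XW M(2) in \<open>auto simp: bij_betw_def\<close>)
    have "sat M e \<phi>" if \<phi>: "\<phi> \<in> inst p as \<union> inst q bs" for \<phi>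
    proof -
      have "wf_fm L (domain B) \<phi>"
      proof -
        have wf: "wf_fm L (domain B) \<phi>" if q': "\<phi> \<in> inst q' cs" "q' \<subseteq> qf_fms L {..<r}" "length cs = r"
          "set cs \<subseteq> domain B" for q' cs
        proof -
          obtain \<psi> where \<psi>: "wf_fm L {..<r} \<psi>" "\<phi> = map_fm id ((!) cs) \<psi>"
            using q'(1,2) unfolding inst_def qf_fms_def by auto
          show ?thesis unfolding \<psi>(2) by (rule wf_map_fm[OF \<psi>(1)]) (use q'(3,4) nth_mem in auto)
        qed
        have "set as \<subseteq> domain B" "set bs \<subseteq> domain B" using dom(3) by auto
        then show ?thesis using \<phi> wf[OF _ sub(1) len(1)] wf[OF _ sub(2) len(2)] by blast
      qed
      then have "sat M e \<phi> \<longleftrightarrow> sat M g \<phi>" using e(2) by (rule sat_cong)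
      moreover have "sat M (\<lambda>a. a) (map_fm id g \<phi>)" using satM eq \<phi> by blast
      ultimately show ?thesis unfolding sat_map_fm by (simp add: comp_def)
    qed
    then have "satisfiable L (inst p as \<union> inst q bs)" unfolding satisfiable_def using M(1) e(1) by blast
    then show False using unsat by simp
  qed
  ultimately show ?thesis using uvU by (intro exI[of _ "{?u, ?v}"]) auto
qed

section \<open>The hypergraph of copies\<close>

lemma card_nsets_containing_le:
  assumes W: "finite W" "card W = n" and Y: "finite Y" "card Y \<le> l"
  shows "card {X \<in> nsets W l. Y \<subseteq> X} \<le> n ^ (l - card Y)"
proof -
  let ?T = "{X \<in> nsets W l. Y \<subseteq> X}"
  have "inj_on (\<lambda>X. X - Y) ?T" by (rule inj_onI) blast
  moreover have "(\<lambda>X. X - Y) ` ?T \<subseteq> nsets W (l - card Y)"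
    using Y(1) by (auto simp: nsets_def card_Diff_subset)
  ultimately have "card ?T \<le> card (nsets W (l - card Y))"
    using finite_imp_finite_nsets[OF W(1)] by (rule card_inj_on_le)
  also have "\<dots> \<le> n ^ (l - card Y)"
    using W(2) by (cases "l - card Y \<le> n") (simp_all add: binomial_le_pow binomial_eq_0)
  finally show ?thesis .
qed

text \<open>Each vertex \<open>v\<close> has an \<open>r\<close>-set \<open>\<sigma> v\<close> as support, and edges are labelled by \<open>l\<close>-sets \<open>X\<close> that contain the
supports of their vertices. A vertex fixes \<open>r\<close> points of \<open>X\<close>, which leaves at most \<open>n\<^bsup>l-r\<^esup>\<close> sets. Two vertices of
one edge have different supports and so fix at least \<open>r + 1\<close> points, which saves a factor \<open>n\<close>.\<close>

lemma hypergraph_of_supported_edges: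
  fixes \<sigma> :: "'v \<Rightarrow> 'w set"
  assumes W: "finite W" "card W = n" "0 < n" and U: "finite U" and E: "E \<subseteq> nsets W l" and r: "r \<le> l" "0 < r"
    and f: "\<And>X. X \<in> E \<Longrightarrow> f X \<subseteq> U \<and> card (f X) = s \<and> (\<forall>v\<in>f X. \<sigma> v \<in> nsets X r) \<and> inj_on \<sigma> (f X)"
  shows "hypergraph U E f s (real n ^ (l - r)) (real n ^ (l - r) / real n)"
proof
  have fW: "finite (nsets W l)" using W(1) by (rule finite_imp_finite_nsets)
  show finE: "finite E" using E fW by (rule finite_subset)
  show "finite U" by fact
  show "f X \<subseteq> U \<and> card (f X) = s" if "X \<in> E" for X using f[OF that] by blast
  show "0 \<le> real n ^ (l - r) / real n" by simp
  show "real (deg E f v) \<le> real n ^ (l - r)" for v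
  proof (cases "{X\<in>E. v \<in> f X} = {}")
    case True
    then show ?thesis unfolding deg_def by (simp only: card.empty) simp
  next
    case False
    then obtain X0 where "X0 \<in> E" "v \<in> f X0" by blast
    then have "\<sigma> v \<in> nsets X0 r" using f by blast
    then have v: "finite (\<sigma> v)" "card (\<sigma> v) = r" unfolding nsets_def by auto
    have "{X\<in>E. v \<in> f X} \<subseteq> {X \<in> nsets W l. \<sigma> v \<subseteq> X}"
    proof
      fix X assume "X \<in> {X\<in>E. v \<in> f X}"
      then have "X \<in> nsets W l" "\<sigma> v \<in> nsets X r" using f E by blast+
      then show "X \<in> {X \<in> nsets W l. \<sigma> v \<subseteq> X}" unfolding nsets_def by simp
    qed
    then have "deg E f v \<le> card {X \<in> nsets W l. \<sigma> v \<subseteq> X}"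
      unfolding deg_def using fW by (intro card_mono) auto
    also have "\<dots> \<le> n ^ (l - r)"
      using card_nsets_containing_le[OF W(1,2) v(1), of l] v(2) r(1) by simp
    finally show ?thesis by (metis of_nat_le_iff of_nat_power)
  qed
  show "real (card {X\<in>E. u \<in> f X \<and> v \<in> f X}) \<le> real n ^ (l - r) / real n" if uv: "u \<noteq> v" for u v
  proof (cases "{X\<in>E. u \<in> f X \<and> v \<in> f X} = {}")
    case True
    then show ?thesis by (simp only: card.empty) simp
  next
    case False
    then obtain X0 where X0: "X0 \<in> E" "u \<in> f X0" "v \<in> f X0" by blast
    have "\<sigma> u \<in> nsets X0 r" "\<sigma> v \<in> nsets X0 r" "inj_on \<sigma> (f X0)" using f[OF X0(1)] X0 by blast+
    then have uv': "finite (\<sigma> u)" "card (\<sigma> u) = r" "finite (\<sigma> v)" "card (\<sigma> v) = r" "\<sigma> u \<noteq> \<sigma> v"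
      "\<sigma> u \<union> \<sigma> v \<subseteq> X0" using uv X0 unfolding nsets_def inj_on_def by auto
    let ?Y = "\<sigma> u \<union> \<sigma> v"
    have "\<sigma> u \<subset> ?Y"
    proof -
      have "\<not> \<sigma> v \<subseteq> \<sigma> u" using card_subset_eq[of "\<sigma> u" "\<sigma> v"] uv' by auto
      then show ?thesis by blast
    qed
    then have "r < card ?Y" using uv' psubset_card_mono[of ?Y "\<sigma> u"] by simp
    moreover have "finite X0" "card X0 = l" using X0(1) E unfolding nsets_def by auto
    then have "card ?Y \<le> l" using uv'(6) card_mono by blast
    ultimately have l: "r < l" "card ?Y \<le> l" "l - card ?Y \<le> l - r - 1" by auto
    have "{X\<in>E. u \<in> f X \<and> v \<in> f X} \<subseteq> {X \<in> nsets W l. ?Y \<subseteq> X}"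
    proof
      fix X assume "X \<in> {X\<in>E. u \<in> f X \<and> v \<in> f X}"
      then have "X \<in> nsets W l" "\<sigma> u \<in> nsets X r" "\<sigma> v \<in> nsets X r" using f E by blast+
      then show "X \<in> {X \<in> nsets W l. ?Y \<subseteq> X}" unfolding nsets_def by simp
    qed
    then have "card {X\<in>E. u \<in> f X \<and> v \<in> f X} \<le> card {X \<in> nsets W l. ?Y \<subseteq> X}"
      using fW by (intro card_mono) auto
    also have "\<dots> \<le> n ^ (l - card ?Y)"
      using card_nsets_containing_le[OF W(1,2) _ l(2)] uv' by simp
    also have "\<dots> \<le> n ^ (l - r - 1)" using l(3) W(3) by (intro power_increasing) auto
    finally have "real (card {X\<in>E. u \<in> f X \<and> v \<in> f X}) \<le> real n ^ (l - r - 1)"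
      by (metis of_nat_le_iff of_nat_power)
    also have "\<dots> = real n ^ (l - r) / real n"
    proof -
      have "l - r = Suc (l - r - 1)" using l(1) by simp
      then have "real n ^ (l - r) = real n * real n ^ (l - r - 1)" by (metis power_Suc)
      then show ?thesis using W(3) by simp
    qed
    finally show ?thesis .
  qed
qed

text \<open>The maximum in the definition is meaningful only for finitely many values. There may be infinitely many
patterns, but their densities are fractions with bounded numerators and boundedly many denominators.\<close>

lemma prob_class_le:
  assumes fin: "finite (domain C)" and size: "\<And>B. B \<in> \<D> \<Longrightarrow> card (domain B) \<le> K"
    and le: "\<And>B. B \<in> \<D> \<Longrightarrow> prob L B C \<le> \<epsilon>" and "0 \<le> \<epsilon>"
  shows "prob_class L \<D> C \<le> \<epsilon>"
proof -
  let ?vals = "(\<lambda>(a, b). real a / real (card (domain C) choose b)) ` ({..card (Pow (domain C))} \<times> {..K})"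
  have "(\<lambda>B. prob L B C) ` \<D> \<subseteq> ?vals"
  proof
    fix x assume "x \<in> (\<lambda>B. prob L B C) ` \<D>"
    then obtain B where B: "B \<in> \<D>" "x = prob L B C" by blast
    have "card (copies L B C) \<le> card (Pow (domain C))"
      using fin by (intro card_mono) (auto simp: copies_def)
    then have "(card (copies L B C), card (domain B)) \<in> {..card (Pow (domain C))} \<times> {..K}"
      using size[OF B(1)] by simp
    then show "x \<in> ?vals" unfolding B(2) prob_eq_copies by (rule rev_image_eqI) simp
  qed
  then have "finite ((\<lambda>B. prob L B C) ` \<D>)" by (rule finite_subset) simp
  then show ?thesis unfolding prob_class_def using le \<open>0 \<le> \<epsilon>\<close> by (subst Max_le_iff) auto
qed

lemma S_const_bound:
  fixes L :: "'s language" and W :: "'v set"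
  assumes "finite_language L" "finite W"
  shows "finite (S_const L r W \<B>)"
    and "card (S_const L r W \<B>) \<le> card {p :: ('s, nat) fm set. complete_qf_type L r p} * card W ^ r"
proof -
  let ?T = "{p :: ('s, nat) fm set. complete_qf_type L r p}"
  have T: "finite ?T" by (rule finite_complete_types[OF assms(1)])
  have D: "finite (dtuples W r)" using finite_tuples[OF assms(2)] unfolding dtuples_def by simp
  have sub: "S_const L r W \<B> \<subseteq> (\<lambda>(p, as). inst p as) ` (?T \<times> dtuples W r)"
    unfolding S_const_def using S_types_complete by fast
  then show "finite (S_const L r W \<B>)" using T D by (meson finite_SigmaI finite_imageI finite_subset)
  have "card (S_const L r W \<B>) \<le> card ((\<lambda>(p, as). inst p as) ` (?T \<times> dtuples W r))"
    using sub T D by (intro card_mono) auto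
  also have "\<dots> \<le> card (?T \<times> dtuples W r)" using T D by (intro card_image_le) auto
  also have "\<dots> \<le> card ?T * card W ^ r"
    using card_dtuples_le[OF assms(2), of r] by (simp add: card_cartesian_product)
  finally show "card (S_const L r W \<B>) \<le> card ?T * card W ^ r" .
qed

text \<open>A proportion \<open>\<epsilon>\<close> of all \<open>l\<close>-sets, expressed in terms of the degree bound \<open>n\<^bsup>l-r\<^esup>\<close> and the bound \<open>t n\<^sup>r\<close> for
the number of vertices. It rests on \<open>(n / l)\<^sup>l \<le> n choose l\<close>, with \<open>l\<^sup>l\<close> replaced by the
uniform \<open>K\<^sup>K\<close>.\<close>

lemma density_lower_bound:
  assumes "l \<le> K" "K \<le> n" "0 < K" "r \<le> l" "0 < \<epsilon>" "0 < t" "\<epsilon> * real (n choose l) \<le> x"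
  shows "\<epsilon> / (real K ^ K * real t) * real n ^ (l - r) * (real t * real n ^ r) \<le> x"
proof -
  have l0: "0 < real l ^ l" by (cases l) auto
  have "real l ^ l \<le> real K ^ l" using assms by (intro power_mono) auto
  also have "\<dots> \<le> real K ^ K" using assms by (intro power_increasing) auto
  finally have lK: "real l ^ l \<le> real K ^ K" .
  have "\<epsilon> / (real K ^ K * real t) * real n ^ (l - r) * (real t * real n ^ r) = \<epsilon> * (real n ^ l / real K ^ K)"
  proof -
    have "real n ^ (l - r) * real n ^ r = real n ^ l" using assms by (simp flip: power_add)
    then show ?thesis using assms by (simp add: field_simps)
  qed
  also have "\<dots> \<le> \<epsilon> * (real n ^ l / real l ^ l)"
    using lK l0 assms by (intro mult_left_mono divide_left_mono mult_pos_pos) auto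
  also have "\<dots> \<le> \<epsilon> * real (n choose l)"
    using binomial_ge_n_over_k_pow_k[of l n] assms by (intro mult_left_mono) (auto simp: power_divide)
  finally show ?thesis using assms by linarith
qed

lemma ln_family_size:
  assumes x: "x \<le> ((t * n ^ r + 1) ^ (J * q)) ^ R" and n: "t + 1 \<le> n"
    and J: "real J \<le> 2 * real t * real n powr \<alpha>"
  shows "ln (real x) \<le> 2 * real R * real q * real t * (real r + 1) * real n powr \<alpha> * ln (real n)"
proof -
  have n1: "1 \<le> n" using n by simp
  have ln_n: "0 \<le> ln (real n)" using n1 by simp
  have "t * n ^ r + 1 \<le> t * n ^ r + n ^ r" using n1 by simp
  also have "\<dots> = (t + 1) * n ^ r" by simp
  also have "\<dots> \<le> n ^ Suc r" using mult_le_mono1[OF n, of "n ^ r"] by simp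
  finally have "t * n ^ r + 1 \<le> n ^ (r + 1)" by simp
  then have "x \<le> ((n ^ (r + 1)) ^ (J * q)) ^ R"
    using x by (meson le_trans power_mono zero_le)
  then have xn: "x \<le> n ^ ((r + 1) * (J * q) * R)" by (simp only: power_mult)
  have "ln (real x) \<le> real ((r + 1) * (J * q) * R) * ln (real n)"
  proof (cases "x = 0")
    case True
    then show ?thesis using ln_n by simp
  next
    case False
    then have "ln (real x) \<le> ln (real n ^ ((r + 1) * (J * q) * R))"
      using xn n1 by (subst ln_le_cancel_iff) (auto simp flip: of_nat_power)
    then show ?thesis using n1 by (simp only: ln_realpow of_nat_0_less_iff)
  qed
  also have "\<dots> = (real R * real q * (real r + 1) * ln (real n)) * real J" by (simp add: algebra_simps)
  also have "\<dots> \<le> (real R * real q * (real r + 1) * ln (real n)) * (2 * real t * real n powr \<alpha>)"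
    using J ln_n by (intro mult_left_mono) auto
  finally show ?thesis by (simp only: mult_ac)
qed

text \<open>The codegree condition of the container lemma for \<open>\<tau> = n\<^bsup>-1/q\<^esup>\<close>: one choice of \<open>\<tau>\<close> serves all uniformities
up to \<open>q + 1\<close>.\<close>

lemma real_root_powr_bound:
  assumes "s \<le> q" "0 < q" "1 \<le> n"
  shows "1 / real n \<le> (real n powr (- 1 / real q)) ^ s"
proof -
  have "1 / real n = real n powr (- 1)" using assms by (simp add: powr_minus_divide)
  also have "\<dots> \<le> real n powr (real s * (- 1 / real q))"
    using assms by (intro powr_mono) (auto simp: field_simps)
  also have "\<dots> = (real n powr (- 1 / real q)) ^ s"
    using assms by (simp add: powr_powr powr_realpow[symmetric] mult.commute)
  finally show ?thesis .
qed

section \<open>Covering the free structures by templates\<close>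

definition free_diagrams :: "nat language \<Rightarrow> nat \<Rightarrow> (nat, nat) struc set \<Rightarrow> nat set \<Rightarrow> (nat, nat) fm set set set" where
  "free_diagrams L r \<F> W = {Diag L M ` nsets W r | M. is_struc L M \<and> domain M = W \<and> is_free L \<F> M}"

text \<open>Forbidden patterns and errors are treated alike from here on: both give edges of a fixed size \<open>s + 1\<close>, one over
each copy, that no \<open>\<F>\<close>-free structure contains.\<close>

lemma bad_pattern_edges:
  fixes L :: "nat language" and \<F> :: "(nat, nat) struc set" and U :: "(nat, nat) fm set set"
  assumes \<F>: "\<And>F. F \<in> \<F> \<Longrightarrow> is_struc L F \<and> finite (domain F) \<and> card (domain F) \<le> k"
    and ar: "\<And>R. R \<in> symbols L \<Longrightarrow> arity L R \<le> r"
    and B: "B \<in> forb_patterns L r \<F> \<union> errors L r (Forb L \<F>)"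
    and q: "(k choose r) + 1 \<le> q"
  shows "\<exists>s\<le>q. \<forall>X\<in>copies (type_language L r (Forb L \<F>)) B (template_of L r (Forb L \<F>) W U).
    \<exists>Y. Y \<subseteq> U \<and> card Y = Suc s \<and> (\<forall>v\<in>Y. supp v \<in> nsets X r) \<and> inj_on supp Y \<and>
      (\<forall>I\<in>free_diagrams L r \<F> W. \<not> Y \<subseteq> I)"
proof (cases "B \<in> forb_patterns L r \<F>")
  case True
  define l where "l = card (domain B)"
  obtain F where F: "F \<in> \<F>" "domain F = domain B" "r \<le> l"
    using True unfolding forb_patterns_def full_subpattern_def l_def by blast
  have "l \<le> k" using \<F>[OF F(1)] F(2) unfolding l_def by simp
  then have "(l choose r) \<le> q" using binomial_right_mono[of l k r] q by linarith
  moreover have "0 < (l choose r)" using F(3) by (simp add: zero_less_binomial)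
  ultimately have s: "(l choose r) - 1 \<le> q" "Suc ((l choose r) - 1) = card (domain B) choose r"
    unfolding l_def by auto
  show ?thesis
  proof (intro exI[of _ "(l choose r) - 1"] conjI ballI)
    show "(l choose r) - 1 \<le> q" by (rule s(1))
    fix X assume X: "X \<in> copies (type_language L r (Forb L \<F>)) B (template_of L r (Forb L \<F>) W U)"
    have "\<exists>Y. Y \<subseteq> U \<and> card Y = card (domain B) choose r \<and> (\<forall>v\<in>Y. supp v \<in> nsets X r) \<and> inj_on supp Y \<and>
        (\<forall>M. is_struc L M \<and> domain M = W \<and> is_free L \<F> M \<longrightarrow> \<not> Y \<subseteq> Diag L M ` nsets W r)"
      by (rule forb_pattern_edge[OF True _ ar X]) (use \<F> in simp_all)
    then obtain Y where Y: "Y \<subseteq> U" "card Y = card (domain B) choose r" "\<forall>v\<in>Y. supp v \<in> nsets X r" "inj_on supp Y"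
      "\<forall>M. is_struc L M \<and> domain M = W \<and> is_free L \<F> M \<longrightarrow> \<not> Y \<subseteq> Diag L M ` nsets W r"
      by (elim exE conjE)
    have "\<forall>I\<in>free_diagrams L r \<F> W. \<not> Y \<subseteq> I" using Y(5) unfolding free_diagrams_def by auto
    then show "\<exists>Y. Y \<subseteq> U \<and> card Y = Suc ((l choose r) - 1) \<and> (\<forall>v\<in>Y. supp v \<in> nsets X r) \<and>
        inj_on supp Y \<and> (\<forall>I\<in>free_diagrams L r \<F> W. \<not> Y \<subseteq> I)"
      unfolding s(2) using Y(1-4) by (intro exI[of _ Y] conjI)
  qed
next
  case False
  then obtain l where l: "is_error L r (Forb L \<F>) l B" "r < l" using B unfolding errors_def by blast
  show ?thesis
  proof (intro exI[of _ 1] conjI ballI)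
    show "1 \<le> q" using q by simp
    fix X assume X: "X \<in> copies (type_language L r (Forb L \<F>)) B (template_of L r (Forb L \<F>) W U)"
    from error_edge[OF l X]
    obtain Y where Y: "Y \<subseteq> U" "card Y = 2" "\<forall>v\<in>Y. supp v \<in> nsets X r" "inj_on supp Y"
      "\<forall>M :: (nat, nat) struc. is_struc L M \<and> domain M = W \<longrightarrow> \<not> Y \<subseteq> Diag L M ` nsets W r"
      by (elim exE conjE)
    have "\<forall>I\<in>free_diagrams L r \<F> W. \<not> Y \<subseteq> I" using Y(5) unfolding free_diagrams_def by auto
    then show "\<exists>Y. Y \<subseteq> U \<and> card Y = Suc 1 \<and> (\<forall>v\<in>Y. supp v \<in> nsets X r) \<and> inj_on supp Y \<and>
        (\<forall>I\<in>free_diagrams L r \<F> W. \<not> Y \<subseteq> I)"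
      using Y(1-4) by (intro exI[of _ Y] conjI) simp_all
  qed
qed

lemma pattern_size:
  assumes \<F>: "\<And>F. F \<in> \<F> \<Longrightarrow> card (domain F) \<le> k"
    and B: "B \<in> forb_patterns L r \<F> \<union> errors L r (Forb L \<F>)"
  shows "r \<le> card (domain B) \<and> card (domain B) \<le> k + 2 * r"
proof (cases "B \<in> forb_patterns L r \<F>")
  case True
  then obtain F where "F \<in> \<F>" "domain F = domain B" "r \<le> card (domain B)"
    unfolding forb_patterns_def full_subpattern_def by blast
  then show ?thesis using \<F>[of F] by simp
next
  case False
  then show ?thesis using B unfolding errors_def is_error_def by auto
qed

text \<open>A pattern of density above \<open>\<epsilon>\<close> in the template of \<open>U\<close> gives a dense hypergraph on \<open>U\<close> for which all \<open>\<F>\<close>-free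
structures are edge-free. The factors \<open>K\<^sup>K\<close> and \<open>t\<close> convert the density among \<open>l\<close>-sets
into edge density relative to \<open>D N\<close>.\<close>

lemma bad_container_step:
  fixes L :: "nat language" and \<F> :: "(nat, nat) struc set" and W :: "nat set" and U :: "(nat, nat) fm set set"
    and k r :: nat
  defines "K \<equiv> k + 2 * r"
  assumes \<F>: "\<And>F. F \<in> \<F> \<Longrightarrow> is_struc L F \<and> finite (domain F) \<and> card (domain F) \<le> k"
    and ar: "\<And>R. R \<in> symbols L \<Longrightarrow> arity L R \<le> r"
    and W: "finite W" "card W = n" "K \<le> n" and r: "0 < r" and q: "(k choose r) + 1 \<le> q"
    and U: "finite U" "card U \<le> t * n ^ r" and t: "0 < t" and \<epsilon>: "0 < \<epsilon>"
    and B: "B \<in> forb_patterns L r \<F> \<union> errors L r (Forb L \<F>)"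
    and dense: "\<epsilon> < prob (type_language L r (Forb L \<F>)) B (template_of L r (Forb L \<F>) W U)"
    and cont: "\<And>s. s \<le> q \<Longrightarrow>
      container_constant TYPE((nat, nat) fm set \<times> nat set) s (\<epsilon> / (real K ^ K * real t)) c"
    and J: "real n powr (- 1 / real q) * real (t * n ^ r) \<le> real J" "real J \<le> c * real (t * n ^ r)"
  shows "coverable {I \<in> free_diagrams L r \<F> W. I \<subseteq> U} ((t * n ^ r + 1) ^ (J * q))
    (\<lambda>C. C \<subseteq> U \<and> real (card C) \<le> real (card U) - c * real (t * n ^ r))"
proof -
  define l where "l = card (domain B)"
  define E where "E = copies (type_language L r (Forb L \<F>)) B (template_of L r (Forb L \<F>) W U)"
  define \<tau> where "\<tau> = real n powr (- 1 / real q)"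
  let ?D = "real n ^ (l - r)"
  have l: "l \<le> K" "r \<le> l" using pattern_size[OF _ B, of k] \<F> unfolding l_def K_def by auto
  have K: "0 < K" using r unfolding K_def by simp
  have n: "1 \<le> n" using K W(3) by simp
  have EW: "E \<subseteq> nsets W l"
  proof
    fix X assume X: "X \<in> E"
    then have "X \<subseteq> W" unfolding E_def copies_def by simp
    moreover have "card X = l" using X card_copy unfolding E_def l_def by blast
    ultimately show "X \<in> nsets W l" using W(1) unfolding nsets_def by (auto intro: finite_subset)
  qed
  have "0 < n choose l" using l W(3) by (simp add: zero_less_binomial)
  then have "\<epsilon> * real (n choose l) \<le> real (card E)"
    using dense W(2) unfolding prob_eq_copies E_def l_def by (simp add: less_divide_eq less_imp_le)
  then have many: "\<epsilon> / (real K ^ K * real t) * ?D * real (t * n ^ r) \<le> real (card E)"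
    using density_lower_bound[OF l(1) W(3) K l(2) \<epsilon> t] by simp
  obtain s where s: "s \<le> q" and ex: "\<forall>X\<in>E. \<exists>Y. Y \<subseteq> U \<and> card Y = Suc s \<and>
      (\<forall>v\<in>Y. supp v \<in> nsets X r) \<and> inj_on supp Y \<and> (\<forall>I\<in>free_diagrams L r \<F> W. \<not> Y \<subseteq> I)"
  proof -
    have "\<exists>s\<le>q. \<forall>X\<in>E. \<exists>Y. Y \<subseteq> U \<and> card Y = Suc s \<and>
        (\<forall>v\<in>Y. supp v \<in> nsets X r) \<and> inj_on supp Y \<and> (\<forall>I\<in>free_diagrams L r \<F> W. \<not> Y \<subseteq> I)"
      unfolding E_def by (rule bad_pattern_edges[OF \<F> ar B q])
    then show thesis using that by (elim exE conjE)
  qed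
  obtain f where f: "\<forall>X\<in>E. f X \<subseteq> U \<and> card (f X) = Suc s \<and>
      (\<forall>v\<in>f X. supp v \<in> nsets X r) \<and> inj_on supp (f X) \<and> (\<forall>I\<in>free_diagrams L r \<F> W. \<not> f X \<subseteq> I)"
    using bchoice[OF ex] by (elim exE)
  have hyp: "hypergraph U E f (Suc s) ?D (?D / real n)"
    by (rule hypergraph_of_supported_edges[OF W(1,2) _ U(1) EW l(2) r, where \<sigma> = supp]) (use f n in auto)
  have "1 / real n * ?D \<le> \<tau> ^ s * ?D"
    using real_root_powr_bound[OF s _ n] q unfolding \<tau>_def by (intro mult_right_mono) auto
  then have codeg: "?D / real n \<le> \<tau> ^ s * ?D" by simp
  have \<tau>: "0 < \<tau>" "\<tau> \<le> 1"
    using n powr_mono[of "- 1 / real q" 0 "real n"] unfolding \<tau>_def by auto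
  have "coverable {I. I \<subseteq> U \<and> edge_free E f I} ((card U + 1) ^ (J * s))
      (\<lambda>C. C \<subseteq> U \<and> real (card C) \<le> real (card U) - c * real (t * n ^ r))"
    by (rule container_constantD[OF cont[OF s] hyp _ \<tau> codeg _ J(1)[folded \<tau>_def] J(2) many])
      (use n U(2) in \<open>simp_all flip: of_nat_mult of_nat_power\<close>)
  then show ?thesis
  proof (rule coverable_mono)
    show "{I \<in> free_diagrams L r \<F> W. I \<subseteq> U} \<subseteq> {I. I \<subseteq> U \<and> edge_free E f I}"
      using f unfolding edge_free_def by auto
    have "(card U + 1) ^ (J * s) \<le> (t * n ^ r + 1) ^ (J * s)" using U(2) by (intro power_mono) auto
    also have "\<dots> \<le> (t * n ^ r + 1) ^ (J * q)" using s by (intro power_increasing) auto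
    finally show "(card U + 1) ^ (J * s) \<le> (t * n ^ r + 1) ^ (J * q)" .
  qed
qed

text \<open>Splitting bad containers, starting with the set of all vertices. Containers over which some \<open>r\<close>-set has no
vertex give no template and are dropped; no structure is lost, since a container of the diagrams of a structure
has a vertex over each \<open>r\<close>-set.\<close>

lemma template_family:
  fixes L :: "nat language" and \<F> :: "(nat, nat) struc set" and W :: "nat set" and k r :: nat
  defines "K \<equiv> k + 2 * r" and "t \<equiv> card {p :: (nat, nat) fm set. complete_qf_type L r p} + 1"
  assumes L: "finite_language L" and ar: "\<And>R. R \<in> symbols L \<Longrightarrow> arity L R \<le> r"
    and \<F>: "\<And>F. F \<in> \<F> \<Longrightarrow> is_struc L F \<and> finite (domain F) \<and> card (domain F) \<le> k"
    and W: "finite W" "card W = n" "K \<le> n" and r: "0 < r" and q: "(k choose r) + 1 \<le> q" and \<epsilon>: "0 < \<epsilon>"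
    and cont: "\<And>s. s \<le> q \<Longrightarrow>
      container_constant TYPE((nat, nat) fm set \<times> nat set) s (\<epsilon> / (real K ^ K * real t)) c"
    and J: "real n powr (- 1 / real q) * real (t * n ^ r) \<le> real J" "real J \<le> c * real (t * n ^ r)"
    and R: "0 < c" "1 \<le> real R * c"
  shows "\<exists>\<C> :: ((nat, nat) fm set, nat) struc set.
    finite \<C> \<and>
    (\<forall>C\<in>\<C>. template L r (Forb L \<F>) C \<and> domain C = W) \<and>
    (\<forall>M. is_struc L M \<and> domain M = W \<and> is_free L \<F> M \<longrightarrow> (\<exists>C\<in>\<C>. full_subpattern L r (Forb L \<F>) M C)) \<and>
    (\<forall>C\<in>\<C>.
       prob_class (type_language L r (Forb L \<F>)) (forb_patterns L r \<F>) C \<le> \<epsilon> \<and>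
       prob_class (type_language L r (Forb L \<F>)) (errors L r (Forb L \<F>)) C \<le> \<epsilon>) \<and>
    card \<C> \<le> ((t * n ^ r + 1) ^ (J * q)) ^ R"
proof -
  let ?B = "Forb L \<F>"
  let ?L = "type_language L r (Forb L \<F>)"
  let ?T = "template_of L r (Forb L \<F>) W"
  let ?\<I> = "free_diagrams L r \<F> W"
  define N where "N = t * n ^ r"
  define V where "V = S_const L r W ?B"
  define G where "G = (N + 1) ^ (J * q)"
  define good where "good U \<longleftrightarrow> (\<forall>B\<in>forb_patterns L r \<F> \<union> errors L r ?B. prob ?L B (?T U) \<le> \<epsilon>)" for U
  have n: "0 < n" using r W(3) unfolding K_def by simp
  have t: "0 < t" unfolding t_def by simp
  have V: "finite V" "card V \<le> N"
  proof -
    show "finite V" unfolding V_def by (rule S_const_bound(1)[OF L W(1)])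
    have "card V \<le> card {p :: (nat, nat) fm set. complete_qf_type L r p} * n ^ r"
      unfolding V_def using S_const_bound(2)[OF L W(1)] W(2) by blast
    also have "\<dots> \<le> N" unfolding N_def t_def by (intro mult_right_mono) auto
    finally show "card V \<le> N" .
  qed
  have step: "coverable {I\<in>?\<I>. I \<subseteq> U} G (\<lambda>C. C \<subseteq> U \<and> real (card C) \<le> real (card U) - c * real N)"
    if U: "U \<subseteq> V" and bad: "\<not> good U" for U
  proof -
    obtain B where B: "B \<in> forb_patterns L r \<F> \<union> errors L r ?B" "\<epsilon> < prob ?L B (?T U)"
      using bad unfolding good_def by force
    have "finite U" using U V(1) by (rule finite_subset)
    moreover have "card U \<le> t * n ^ r" using card_mono[OF V(1) U] V(2) unfolding N_def by linarith
    ultimately show ?thesis unfolding G_def N_def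
      using bad_container_step[OF \<F> ar W(1,2) W(3)[unfolded K_def] r q _ _ t \<epsilon> B cont[unfolded K_def] J] by blast
  qed
  have "coverable {I\<in>?\<I>. I \<subseteq> V} (G ^ R) (\<lambda>C. C \<subseteq> V \<and> good C)"
  proof (rule coverable_iterate[OF step V(1)])
    show "0 < c * real N" using R(1) t n unfolding N_def by (intro mult_pos_pos) auto
    have "real N \<le> real R * c * real N" using R(2) mult_right_mono[of 1 "real R * c" "real N"] by simp
    then show "real (card V) \<le> real R * (c * real N)" using V(2) by (simp add: mult.assoc)
  qed (auto simp: G_def)
  then obtain \<D> where \<D>: "finite \<D>" "card \<D> \<le> G ^ R" "\<forall>U\<in>\<D>. U \<subseteq> V \<and> good U"
    "\<forall>I\<in>{I\<in>?\<I>. I \<subseteq> V}. \<exists>U\<in>\<D>. I \<subseteq> U" unfolding coverable_def by (elim exE conjE)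
  define \<C> where "\<C> = {C \<in> ?T ` \<D>. template L r ?B C}"
  show ?thesis
  proof (intro exI[of _ \<C>] conjI ballI allI impI)
    show "finite \<C>" using \<D>(1) unfolding \<C>_def by simp
    show "template L r ?B C" "domain C = W" if "C \<in> \<C>" for C using that unfolding \<C>_def by auto
    show "\<exists>C\<in>\<C>. full_subpattern L r ?B M C" if "is_struc L M \<and> domain M = W \<and> is_free L \<F> M" for M
    proof -
      have M: "is_struc L M" "domain M = W" "is_free L \<F> M" "finite (domain M)" using that W(1) by auto
      have "Diag L M ` nsets W r \<subseteq> V"
      proof (rule image_subsetI)
        fix A assume "A \<in> nsets W r"
        then show "Diag L M A \<in> V" unfolding V_def S_const_def
          using Diag_obtain_inst[OF M(1,4,3), of A r] M(2) by blast
      qed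
      moreover have "Diag L M ` nsets W r \<in> ?\<I>" unfolding free_diagrams_def using M by blast
      ultimately obtain U where U: "U \<in> \<D>" "Diag L M ` nsets W r \<subseteq> U" using \<D>(4) by blast
      note sub = full_subpattern_template_of[OF M(1) W(1) M(2,3) U(2)]
      then have "?T U \<in> \<C>" using U(1) unfolding \<C>_def by simp
      then show ?thesis using sub(2) by blast
    qed
    show "prob_class ?L (forb_patterns L r \<F>) C \<le> \<epsilon>" "prob_class ?L (errors L r ?B) C \<le> \<epsilon>"
      if C: "C \<in> \<C>" for C
    proof -
      obtain U where U: "U \<in> \<D>" "C = ?T U" using C unfolding \<C>_def by auto
      then have "good U" using \<D>(3) by simp
      then have *: "prob ?L B C \<le> \<epsilon>" if "B \<in> forb_patterns L r \<F> \<union> errors L r ?B" for B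
        using that U(2) unfolding good_def by simp
      have "card (domain B) \<le> K" if "B \<in> forb_patterns L r \<F> \<union> errors L r ?B" for B
        using pattern_size[OF _ that, of k] \<F> unfolding K_def by simp
      moreover have "finite (domain C)" using U(2) W(1) by simp
      ultimately show "prob_class ?L (forb_patterns L r \<F>) C \<le> \<epsilon>" "prob_class ?L (errors L r ?B) C \<le> \<epsilon>"
        using * \<epsilon> by (intro prob_class_le[where K = K]; simp)+
    qed
    have "card \<C> \<le> card (?T ` \<D>)" using \<D>(1) unfolding \<C>_def by (intro card_mono) auto
    also have "\<dots> \<le> card \<D>" using \<D>(1) by (rule card_image_le)
    also have "\<dots> \<le> ((t * n ^ r + 1) ^ (J * q)) ^ R" using \<D>(2) unfolding G_def N_def .
    finally show "card \<C> \<le> ((t * n ^ r + 1) ^ (J * q)) ^ R" .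
  qed
qed

text \<open>The number \<open>\<nu> = \<tau> t n\<^sup>r\<close> of vertices that must be chosen in the walk, rounded up, is
at most \<open>c t n\<^sup>r\<close> for large \<open>n\<close>, and its order \<open>n\<^bsup>r - 1/q\<^esup>\<close> reappears in the bound for the
logarithm of the number of templates.\<close>

lemma fingerprint_size:
  fixes t n r q :: nat and c :: real
  defines "\<nu> \<equiv> real n powr (- 1 / real q) * real (t * n ^ r)"
  assumes "0 < t" "1 \<le> r" "1 \<le> q" "1 \<le> n" "0 < c"
    and small: "real n powr (- 1 / real q) < c / 2" and large: "2 / c \<le> real n"
  shows "\<nu> \<le> real (nat \<lceil>\<nu>\<rceil>)" "real (nat \<lceil>\<nu>\<rceil>) \<le> c * real (t * n ^ r)"
    "real (nat \<lceil>\<nu>\<rceil>) \<le> 2 * real t * real n powr (real r - 1 / real q)"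
proof -
  have \<nu>: "\<nu> = real t * real n powr (real r - 1 / real q)"
  proof -
    have "real n powr (real r - 1 / real q) = real n powr (real r) * real n powr (- 1 / real q)"
      by (simp flip: powr_add)
    then show ?thesis using assms unfolding \<nu>_def by (simp add: powr_realpow)
  qed
  have "1 / real q \<le> 1" "1 \<le> real r" using assms by auto
  then have "0 \<le> real r - 1 / real q" by linarith
  then have "1 \<le> real n powr (real r - 1 / real q)" using \<open>1 \<le> n\<close> by (intro ge_one_powr_ge_zero) auto
  moreover have "1 \<le> real t" using assms by simp
  ultimately have "1 * 1 \<le> \<nu>" unfolding \<nu> by (intro mult_mono) auto
  then show lower: "\<nu> \<le> real (nat \<lceil>\<nu>\<rceil>)" and "real (nat \<lceil>\<nu>\<rceil>) \<le> 2 * real t * real n powr (real r - 1 / real q)"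
    using \<nu> by linarith+
  have "n \<le> n ^ r" using assms by (simp add: self_le_power)
  also have "\<dots> \<le> t * n ^ r" using assms by simp
  finally have "real n \<le> real (t * n ^ r)" by (simp only: of_nat_le_iff)
  then have "2 / c \<le> real (t * n ^ r)" using large by linarith
  then have "1 \<le> c / 2 * real (t * n ^ r)" using \<open>0 < c\<close> by (simp add: field_simps)
  moreover have "\<nu> \<le> c / 2 * real (t * n ^ r)"
    unfolding \<nu>_def using small by (intro mult_right_mono) auto
  ultimately show "real (nat \<lceil>\<nu>\<rceil>) \<le> c * real (t * n ^ r)"
    using \<open>1 * 1 \<le> \<nu>\<close> by linarith
qed

text \<open>All constants depend on \<open>k\<close>, \<open>r\<close>, \<open>L\<close> and \<open>\<epsilon>\<close> only: \<open>t\<close> counts all complete types of \<open>L\<close>, not just those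
realized in \<open>\<F>\<close>-free structures. The number \<open>R\<close> of rounds is the inverse of \<open>d\<close>, rounded up, as each
split removes at least \<open>d t n\<^sup>r\<close> of the at most \<open>t n\<^sup>r\<close> vertices.\<close>

lemma template_families_eventually:
  fixes L :: "nat language" and k r :: nat and \<epsilon> :: real
  defines "q \<equiv> (k choose r) + 2"
  assumes "finite_language L" and "max_arity L = r" and "0 < r" and \<epsilon>: "0 < \<epsilon>"
  shows "\<exists>c::real. 0 < c \<and>
    (\<forall>\<^sub>F n in sequentially.
      \<forall>\<F> :: (nat, nat) struc set.
        (\<forall>F\<in>\<F>. is_struc L F \<and> finite (domain F) \<and> card (domain F) \<le> k) \<and>
        Forb L \<F> \<noteq> {} \<longrightarrow>
        (\<forall>W :: nat set. finite W \<and> card W = n \<longrightarrow>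
          (\<exists>\<C> :: ((nat, nat) fm set, nat) struc set.
             finite \<C> \<and>
             (\<forall>C\<in>\<C>. template L r (Forb L \<F>) C \<and> domain C = W) \<and>
             (\<forall>M. is_struc L M \<and> domain M = W \<and> is_free L \<F> M \<longrightarrow>
                (\<exists>C\<in>\<C>. full_subpattern L r (Forb L \<F>) M C)) \<and>
             (\<forall>C\<in>\<C>.
                prob_class (type_language L r (Forb L \<F>)) (forb_patterns L r \<F>) C \<le> \<epsilon> \<and>
                prob_class (type_language L r (Forb L \<F>)) (errors L r (Forb L \<F>)) C \<le> \<epsilon>) \<and>
             ln (real (card \<C>)) \<le> c * real n powr (real r - 1 / real q) * ln (real n))))"
    (is "\<exists>c. 0 < c \<and> (\<forall>\<^sub>F n in sequentially. ?P c n)")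
proof -
  define K where "K = k + 2 * r"
  define t where "t = card {p :: (nat, nat) fm set. complete_qf_type L r p} + 1"
  have pos: "0 < K" "0 < t" "1 \<le> q" "(k choose r) + 1 \<le> q"
    using \<open>0 < r\<close> unfolding K_def t_def q_def by auto
  have ar: "arity L R \<le> r" if "R \<in> symbols L" for R
    using assms(2,3) that unfolding finite_language_def max_arity_def by auto
  have "0 < \<epsilon> / (real K ^ K * real t)" using \<epsilon> pos by simp
  then have "\<exists>c>0. \<forall>s\<le>q. container_constant TYPE((nat, nat) fm set \<times> nat set) s (\<epsilon> / (real K ^ K * real t)) c"
    by (rule uniform_container_constant)
  then obtain d where d: "0 < d" and
    cont: "\<forall>s\<le>q. container_constant TYPE((nat, nat) fm set \<times> nat set) s (\<epsilon> / (real K ^ K * real t)) d"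
    by (elim exE conjE)
  define R where "R = nat \<lceil>1 / d\<rceil>"
  have "1 / d \<le> real R" unfolding R_def by linarith
  then have Rd: "1 \<le> real R * d" using d by (simp add: divide_le_eq)
  then have R0: "0 < R" by (cases R) auto
  define c where "c = 2 * real R * real q * real t * (real r + 1)"
  have "((\<lambda>n. real n powr (- 1 / real q)) \<longlongrightarrow> 0) sequentially"
    using pos by (intro tendsto_neg_powr filterlim_real_sequentially) simp
  then have small: "\<forall>\<^sub>F n in sequentially. real n powr (- 1 / real q) < d / 2"
    using d by (intro order_tendstoD(2)) auto
  have large: "\<forall>\<^sub>F n in sequentially. max K (max (t + 1) (nat \<lceil>2 / d\<rceil>)) \<le> n"
    by (rule eventually_ge_at_top)
  have "\<forall>\<^sub>F n in sequentially. ?P c n"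
    using small large
  proof (eventually_elim, intro allI impI, elim conjE)
    fix n and \<F> :: "(nat, nat) struc set" and W :: "nat set"
    assume small: "real n powr (- 1 / real q) < d / 2" and big: "max K (max (t + 1) (nat \<lceil>2 / d\<rceil>)) \<le> n"
      and \<F>: "\<forall>F\<in>\<F>. is_struc L F \<and> finite (domain F) \<and> card (domain F) \<le> k" and W: "finite W" "card W = n"
    have n: "K \<le> n" "t + 1 \<le> n" "2 / d \<le> real n" "1 \<le> n"
      using big pos by (auto simp: ceiling_le_iff nat_le_iff)
    define J where "J = nat \<lceil>real n powr (- 1 / real q) * real (t * n ^ r)\<rceil>"
    have J: "real n powr (- 1 / real q) * real (t * n ^ r) \<le> real J" "real J \<le> d * real (t * n ^ r)"
      "real J \<le> 2 * real t * real n powr (real r - 1 / real q)"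
      unfolding J_def by (rule fingerprint_size; use pos \<open>0 < r\<close> n d small in simp)+
    have "\<exists>\<C> :: ((nat, nat) fm set, nat) struc set.
        finite \<C> \<and>
        (\<forall>C\<in>\<C>. template L r (Forb L \<F>) C \<and> domain C = W) \<and>
        (\<forall>M. is_struc L M \<and> domain M = W \<and> is_free L \<F> M \<longrightarrow> (\<exists>C\<in>\<C>. full_subpattern L r (Forb L \<F>) M C)) \<and>
        (\<forall>C\<in>\<C>.
           prob_class (type_language L r (Forb L \<F>)) (forb_patterns L r \<F>) C \<le> \<epsilon> \<and>
           prob_class (type_language L r (Forb L \<F>)) (errors L r (Forb L \<F>)) C \<le> \<epsilon>) \<and>
        card \<C> \<le> ((t * n ^ r + 1) ^ (J * q)) ^ R"
      unfolding t_def
      by (rule template_family[OF assms(2) ar _ W n(1)[unfolded K_def] \<open>0 < r\<close> pos(4) \<epsilon>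
            cont[unfolded K_def t_def, rule_format] J(1,2)[unfolded t_def] d Rd]) (use \<F> in simp_all)
    then obtain \<C> :: "((nat, nat) fm set, nat) struc set" where \<C>: "finite \<C>"
      "\<forall>C\<in>\<C>. template L r (Forb L \<F>) C \<and> domain C = W"
      "\<forall>M. is_struc L M \<and> domain M = W \<and> is_free L \<F> M \<longrightarrow> (\<exists>C\<in>\<C>. full_subpattern L r (Forb L \<F>) M C)"
      "\<forall>C\<in>\<C>. prob_class (type_language L r (Forb L \<F>)) (forb_patterns L r \<F>) C \<le> \<epsilon> \<and>
        prob_class (type_language L r (Forb L \<F>)) (errors L r (Forb L \<F>)) C \<le> \<epsilon>"
      "card \<C> \<le> ((t * n ^ r + 1) ^ (J * q)) ^ R"
      by (elim exE conjE)
    have "ln (real (card \<C>)) \<le> c * real n powr (real r - 1 / real q) * ln (real n)"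
      unfolding c_def by (rule ln_family_size[OF \<C>(5) n(2) J(3)])
    then show "\<exists>\<C> :: ((nat, nat) fm set, nat) struc set.
        finite \<C> \<and>
        (\<forall>C\<in>\<C>. template L r (Forb L \<F>) C \<and> domain C = W) \<and>
        (\<forall>M. is_struc L M \<and> domain M = W \<and> is_free L \<F> M \<longrightarrow> (\<exists>C\<in>\<C>. full_subpattern L r (Forb L \<F>) M C)) \<and>
        (\<forall>C\<in>\<C>.
           prob_class (type_language L r (Forb L \<F>)) (forb_patterns L r \<F>) C \<le> \<epsilon> \<and>
           prob_class (type_language L r (Forb L \<F>)) (errors L r (Forb L \<F>)) C \<le> \<epsilon>) \<and>
        ln (real (card \<C>)) \<le> c * real n powr (real r - 1 / real q) * ln (real n)"
      using \<C>(1-4) by (intro exI[of _ \<C>] conjI)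
  qed
  moreover have "0 < c" using R0 pos unfolding c_def by simp
  ultimately show ?thesis by (intro exI[of _ c] conjI)
qed

theorem theorem6:
  fixes k r :: nat
  assumes "2 \<le> r" and "r \<le> k"
  shows "\<exists>m::real. 1 < m \<and>
    (\<forall>(L :: nat language) (\<epsilon>::real).
       finite_language L \<and> max_arity L = r \<and> 0 < \<epsilon> \<and> \<epsilon> < 1 \<longrightarrow>
       (\<exists>c::real. 0 < c \<and>
         (\<forall>\<^sub>F n in sequentially.
           \<forall>\<F> :: (nat, nat) struc set.
             (\<forall>F\<in>\<F>. is_struc L F \<and> finite (domain F) \<and> card (domain F) \<le> k) \<and>
             Forb L \<F> \<noteq> {} \<longrightarrow>
             (\<forall>W :: nat set. finite W \<and> card W = n \<longrightarrow>
               (\<exists>\<C> :: ((nat, nat) fm set, nat) struc set.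
                  finite \<C> \<and>
                  (\<forall>C\<in>\<C>. template L r (Forb L \<F>) C \<and> domain C = W) \<and>
                  (\<forall>M. is_struc L M \<and> domain M = W \<and> is_free L \<F> M \<longrightarrow>
                     (\<exists>C\<in>\<C>. full_subpattern L r (Forb L \<F>) M C)) \<and>
                  (\<forall>C\<in>\<C>.
                     prob_class (type_language L r (Forb L \<F>)) (forb_patterns L r \<F>) C \<le> \<epsilon> \<and>
                     prob_class (type_language L r (Forb L \<F>)) (errors L r (Forb L \<F>)) C \<le> \<epsilon>) \<and>
                  ln (real (card \<C>)) \<le> c * real n powr (real r - 1 / m) * ln (real n))))))"
proof (rule exI[of _ "real ((k choose r) + 2)"], rule conjI)
  show "1 < real ((k choose r) + 2)" by simp
qed (intro allI impI, elim conjE, rule template_families_eventually, use assms in simp_all)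

end
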